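(* Let $n\ge3$, $A=TM\setminus\mathbf{0}$, and let $L(v)=g_R(v,v)$ for a (positive definite) Riemannian metric $g_R$ on $M$. Then $\mathrm{N}^L$ is the only symmetric solution, among the homogeneous nonlinear connections on $TM\setminus\mathbf{0}$, of the affine equation of $L$.
   Context: $M$ is a connected smooth manifold of dimension $n$, $\pi:TM\to M$ the projection. Charts $(x^i)$ of $M$ induce charts $(x^i,y^i)$ of $TM$; $\partial_i=\partial/\partial x^i$, $\dot\partial_i=\partial/\partial y^i$; repeated indices are summed; a subscript $\cdot i$ denotes $\dot\partial_i$. An anisotropic tensor of type $(r,s)$ on $A=TM\setminus\mathbf 0$ is a smooth section of the pullback to $A$ of $\bigotimes^rTM\otimes\bigotimes^sT^*M$, with components $T^{i_1\dots i_r}_{j_1\dots j_s}(x,y)$; the space of those with components positively $\alpha$-homogeneous in $y$ is $\mathrm{h}^\alpha\mathcal{T}^r_s(M_A)$. A homogeneous nonlinear connection $\mathrm{N}$ on $A$ is given in each chart by smooth functions $\mathrm{N}_i^k(x,y)$, positively $1$-homogeneous in $y$, transforming by $\bar{\mathrm{N}}_i^k=\frac{\partial\bar x^k}{\partial x^c}\frac{\partial^2x^c}{\partial\bar x^i\partial\bar x^b}\bar y^b+\frac{\partial\bar x^k}{\partial x^c}\frac{\partial x^a}{\partial\bar x^i}\mathrm{N}_a^c$. Differences of two such lie in $\mathrm{h}^1\mathcal{T}^1_1(M_A)$. $\mathrm{N}$ is symmetric if $\mathrm{N}^k_{i\cdot j}=\mathrm{N}^k_{j\cdot i}$. For a pseudo-Finsler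 metric $L$ (a smooth positively $2$-homogeneous function with $g_{ij}=\frac12L_{\cdot i\cdot j}$ non-degenerate), indices are moved with $g$ and $y_i=g_{ia}y^a$. $(\mathrm{G}^L)^i=\frac14g^{ia}(2\partial_cg_{ab}-\partial_ag_{bc})y^by^c$; $(\mathrm{N}^L)_i^k=\dot\partial_i(\mathrm{G}^L)^k$. $\mathrm{C}_{ijk}=\frac12g_{ij\cdot k}$, $\mathrm{C}_i=g^{ab}\mathrm{C}_{abi}$. $\mathrm{Lan}_{ijk}=\frac12\nabla^L_kg_{ij}$ with $\nabla^L_kg_{ij}=(\partial_k-(\mathrm{N}^L)_k^a\dot\partial_a)g_{ij}-(\mathrm{N}^L)^a_{k\cdot i}g_{aj}-(\mathrm{N}^L)^a_{k\cdot j}g_{ia}$, $\mathrm{Lan}_i=g^{ab}\mathrm{Lan}_{abi}$. (For $L$ Riemannian, $\mathrm{C}_i=0$, $\mathrm{Lan}_i=0$, and $\mathrm{N}^L$ is given by the Levi-Civita connection.) $\mathrm{N}=\mathrm{N}^L+\mathcal{J}$, $\mathcal{J}\in\mathrm{h}^1\mathcal{T}^1_1(M_A)$, is a solution of the affine equation of $L$ if on $A$ $$\Big\{2\mathrm{Lan}_b+(n+2)\tfrac{y_a}{L}\mathcal{J}^a_b-2\mathrm{C}_a\mathcal{J}^a_b-(\mathcal{J}^a_{b\cdot a}+\mathcal{J}^a_{a\cdot b})\Big\}(\delta^b_iy^j-y^b\delta^j_i)-(\mathcal{J}^j_{i\cdot a}-\mathcal{J}^j_{a\cdot i})y^a=0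 .$$ *)

theory Defs
  imports "HOL-Analysis.Analysis"
begin

section \<open>Smooth functions and partial derivatives\<close>

text \<open>Both notions are meant for open sets \<open>S\<close>; on a Euclidean space, \<open>Ck_on k S f\<close> says that \<open>f\<close> is
  \<open>k\<close> times continuously differentiable on \<open>S\<close>.\<close>

primrec Ck_on ::
  "nat \<Rightarrow> 'a::euclidean_space set \<Rightarrow> ('a \<Rightarrow> 'b::real_normed_vector) \<Rightarrow> bool" where
  "Ck_on 0 S f \<longleftrightarrow> continuous_on S f"
| "Ck_on (Suc k) S f \<longleftrightarrow>
     (\<forall>x\<in>S. f differentiable at x) \<and> (\<forall>v. Ck_on k S (\<lambda>x. frechet_derivative f (at x) v))"

definition smooth_on :: "'a::euclidean_space set \<Rightarrow> ('a \<Rightarrow> 'b::real_normed_vector) \<Rightarrow> bool" where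
  "smooth_on S f \<longleftrightarrow> (\<forall>k. Ck_on k S f)"

definition pd :: "'n::finite \<Rightarrow> (real^'n \<Rightarrow> real) \<Rightarrow> real^'n \<Rightarrow> real" where
  "pd i f x = frechet_derivative f (at x) (axis i 1)"

text \<open>Functions of the induced coordinates \<open>(x, y)\<close> of \<open>TM\<close>; \<open>dx i\<close> and \<open>dy i\<close> are
  \<open>\<partial>/\<partial>x\<^sup>i\<close> and \<open>\<partial>/\<partial>y\<^sup>i\<close>.\<close>

type_synonym 'n cfun = "real^'n \<Rightarrow> real^'n \<Rightarrow> real"

definition dx :: "'n::finite \<Rightarrow> 'n cfun \<Rightarrow> 'n cfun" where
  "dx i f x y = pd i (\<lambda>z. f z y) x"

definition dy :: "'n::finite \<Rightarrow> 'n cfun \<Rightarrow> 'n cfun" where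
  "dy i f x y = pd i (f x) y"


section \<open>Smooth manifolds and the tangent bundle\<close>

text \<open>A chart is an open set together with a coordinate map; the values of the map outside the
  set are irrelevant.\<close>

type_synonym ('a, 'n) chart = "'a set \<times> ('a \<Rightarrow> real^'n)"

definition is_chart :: "'a topology \<Rightarrow> ('a, 'n::finite) chart \<Rightarrow> bool" where
  "is_chart X c \<longleftrightarrow> openin X (fst c) \<and> open (snd c ` fst c) \<and>
     homeomorphic_map (subtopology X (fst c)) (top_of_set (snd c ` fst c)) (snd c)"

definition chart_inv :: "('a, 'n::finite) chart \<Rightarrow> real^'n \<Rightarrow> 'a" where
  "chart_inv c = inv_into (fst c) (snd c)"

definition transition :: "('a, 'n::finite) chart \<Rightarrow> ('a, 'n) chart \<Rightarrow> real^'n \<Rightarrow> real^'n" where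
  "transition c d = snd d \<circ> chart_inv c"

definition compatible :: "('a, 'n::finite) chart \<Rightarrow> ('a, 'n) chart \<Rightarrow> bool" where
  "compatible c d \<longleftrightarrow>
     smooth_on (snd c ` (fst c \<inter> fst d)) (transition c d) \<and>
     smooth_on (snd d ` (fst c \<inter> fst d)) (transition d c)"

text \<open>\<open>\<A>\<close> is a maximal smooth atlas. The dimension of the manifold is \<open>CARD('n)\<close>.\<close>

definition smooth_manifold :: "'a topology \<Rightarrow> ('a, 'n::finite) chart set \<Rightarrow> bool" where
  "smooth_manifold X \<A> \<longleftrightarrow>
     Hausdorff_space X \<and> second_countable X \<and>
     (\<forall>c\<in>\<A>. is_chart X c) \<and> (\<Union>c\<in>\<A>. fst c) = topspace X \<and>
     (\<forall>c\<in>\<A>. \<forall>d\<in>\<A>. compatible c d) \<and>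
     (\<forall>c. is_chart X c \<and> (\<forall>d\<in>\<A>. compatible c d) \<longrightarrow> c \<in> \<A>)"

text \<open>A tangent vector at \<open>p\<close> is the family of its components \<open>v c\<close> in the charts \<open>c\<close> around \<open>p\<close>,
  related by the Jacobians of the transition maps. The family is set to \<open>0\<close> at the other charts,
  so that equality of tangent vectors is equality of families.\<close>

type_synonym ('a, 'n) tvec = "('a, 'n) chart \<Rightarrow> real^'n"

definition tangent_space :: "('a, 'n::finite) chart set \<Rightarrow> 'a \<Rightarrow> ('a, 'n) tvec set" where
  "tangent_space \<A> p = {v.
     (\<forall>c. c \<notin> \<A> \<or> p \<notin> fst c \<longrightarrow> v c = 0) \<and>
     (\<forall>c\<in>\<A>. \<forall>d\<in>\<A>. p \<in> fst c \<inter> fst d \<longrightarrow>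
        v d = frechet_derivative (transition c d) (at (snd c p)) (v c))}"

definition tadd :: "('a, 'n::finite) tvec \<Rightarrow> ('a, 'n) tvec \<Rightarrow> ('a, 'n) tvec" where
  "tadd v w = (\<lambda>c. v c + w c)"

definition tscale :: "real \<Rightarrow> ('a, 'n::finite) tvec \<Rightarrow> ('a, 'n) tvec" where
  "tscale a v = (\<lambda>c. a *\<^sub>R v c)"

text \<open>The tangent vector at \<open>p\<close> with components \<open>y\<close> in the chart \<open>c\<close>.\<close>

definition tvec_of ::
  "('a, 'n::finite) chart set \<Rightarrow> ('a, 'n) chart \<Rightarrow> 'a \<Rightarrow> real^'n \<Rightarrow> ('a, 'n) tvec" where
  "tvec_of \<A> c p y = (\<lambda>d. if d \<in> \<A> \<and> p \<in> fst d
     then frechet_derivative (transition c d) (at (snd c p)) y else 0)"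

definition coord_vec ::
  "('a, 'n::finite) chart set \<Rightarrow> ('a, 'n) chart \<Rightarrow> 'a \<Rightarrow> 'n \<Rightarrow> ('a, 'n) tvec" where
  "coord_vec \<A> c p i = tvec_of \<A> c p (axis i 1)"

text \<open>\<open>TM\<close> without the zero section.\<close>

definition slit_TM :: "'a topology \<Rightarrow> ('a, 'n::finite) chart set \<Rightarrow> ('a \<times> ('a, 'n) tvec) set" where
  "slit_TM X \<A> = {(p, v). p \<in> topspace X \<and> v \<in> tangent_space \<A> p \<and> v \<noteq> (\<lambda>_. 0)}"

text \<open>The inverse of the chart of \<open>TM\<close> induced by \<open>c\<close>, and the range in which the coordinates
  \<open>(x, y)\<close> of \<open>slit_TM\<close> vary.\<close>

definition TM_point ::
  "('a, 'n::finite) chart set \<Rightarrow> ('a, 'n) chart \<Rightarrow> real^'n \<Rightarrow> real^'n \<Rightarrow> 'a \<times> ('a, 'n) tvec" where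
  "TM_point \<A> c x y = (chart_inv c x, tvec_of \<A> c (chart_inv c x) y)"

definition slit_coords :: "('a, 'n::finite) chart \<Rightarrow> ((real^'n) \<times> (real^'n)) set" where
  "slit_coords c = (snd c ` fst c) \<times> (- {0})"

definition local_rep ::
  "('a, 'n::finite) chart set \<Rightarrow> ('a \<times> ('a, 'n) tvec \<Rightarrow> real) \<Rightarrow> ('a, 'n) chart \<Rightarrow> 'n cfun" where
  "local_rep \<A> F c x y = F (TM_point \<A> c x y)"

definition smooth_cfun :: "('a, 'n::finite) chart \<Rightarrow> 'n cfun \<Rightarrow> bool" where
  "smooth_cfun c f \<longleftrightarrow> smooth_on (slit_coords c) (\<lambda>(x, y). f x y)"

definition homog_cfun :: "real \<Rightarrow> ('a, 'n::finite) chart \<Rightarrow> 'n cfun \<Rightarrow> bool" where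
  "homog_cfun \<alpha> c f \<longleftrightarrow>
     (\<forall>(x, y)\<in>slit_coords c. \<forall>t>0. f x (t *\<^sub>R y) = t powr \<alpha> * f x y)"


section \<open>Riemannian metrics, anisotropic tensors, nonlinear connections\<close>

definition riemannian_metric ::
  "'a topology \<Rightarrow> ('a, 'n::finite) chart set \<Rightarrow> ('a \<Rightarrow> ('a, 'n) tvec \<Rightarrow> ('a, 'n) tvec \<Rightarrow> real) \<Rightarrow> bool" where
  "riemannian_metric X \<A> gR \<longleftrightarrow>
     (\<forall>p\<in>topspace X.
        (\<forall>u\<in>tangent_space \<A> p. \<forall>v\<in>tangent_space \<A> p. \<forall>w\<in>tangent_space \<A> p. \<forall>a b.
           gR p (tadd (tscale a u) (tscale b v)) w = a * gR p u w + b * gR p v w) \<and>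
        (\<forall>v\<in>tangent_space \<A> p. \<forall>w\<in>tangent_space \<A> p. gR p v w = gR p w v) \<and>
        (\<forall>v\<in>tangent_space \<A> p. v \<noteq> (\<lambda>_. 0) \<longrightarrow> gR p v v > 0)) \<and>
     (\<forall>c\<in>\<A>. \<forall>i j. smooth_on (snd c ` fst c)
        (\<lambda>x. gR (chart_inv c x) (coord_vec \<A> c (chart_inv c x) i)
                                (coord_vec \<A> c (chart_inv c x) j)))"

text \<open>Anisotropic tensors of type \<open>(1,1)\<close>: the value at \<open>v \<in> T\<^sub>pM - 0\<close>, an element of
  \<open>T\<^sub>pM \<otimes> T\<^sub>p\<^sup>*M\<close>, is a linear endomorphism of \<open>T\<^sub>pM\<close>. In component arrays such as
  \<open>comp11 \<A> J c k i\<close> (for \<open>J\<^sup>k\<^sub>i\<close>) the upper index comes first.\<close>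

type_synonym ('a, 'n) atensor11 = "'a \<times> ('a, 'n) tvec \<Rightarrow> ('a, 'n) tvec \<Rightarrow> ('a, 'n) tvec"

definition comp11 ::
  "('a, 'n::finite) chart set \<Rightarrow> ('a, 'n) atensor11 \<Rightarrow> ('a, 'n) chart \<Rightarrow> 'n \<Rightarrow> 'n \<Rightarrow> 'n cfun" where
  "comp11 \<A> J c k i x y = J (TM_point \<A> c x y) (coord_vec \<A> c (chart_inv c x) i) c $ k"

definition anisotropic_tensor11 ::
  "'a topology \<Rightarrow> ('a, 'n::finite) chart set \<Rightarrow> ('a, 'n) atensor11 \<Rightarrow> bool" where
  "anisotropic_tensor11 X \<A> J \<longleftrightarrow>
     (\<forall>(p, v)\<in>slit_TM X \<A>.
        (\<forall>w\<in>tangent_space \<A> p. J (p, v) w \<in> tangent_space \<A> p) \<and>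
        (\<forall>u\<in>tangent_space \<A> p. \<forall>w\<in>tangent_space \<A> p. \<forall>a b.
           J (p, v) (tadd (tscale a u) (tscale b w)) =
           tadd (tscale a (J (p, v) u)) (tscale b (J (p, v) w)))) \<and>
     (\<forall>c\<in>\<A>. \<forall>k i. smooth_cfun c (comp11 \<A> J c k i))"

definition homog_tensor11 ::
  "real \<Rightarrow> 'a topology \<Rightarrow> ('a, 'n::finite) chart set \<Rightarrow> ('a, 'n) atensor11 \<Rightarrow> bool" where
  "homog_tensor11 \<alpha> X \<A> J \<longleftrightarrow> anisotropic_tensor11 X \<A> J \<and>
     (\<forall>c\<in>\<A>. \<forall>k i. homog_cfun \<alpha> c (comp11 \<A> J c k i))"

text \<open>\<open>jac c d k a\<close> is \<open>\<partial>z\<^sup>k/\<partial>x\<^sup>a\<close> and \<open>hess c d k a b\<close> is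
  \<open>\<partial>\<^sup>2z\<^sup>k/\<partial>x\<^sup>a\<partial>x\<^sup>b\<close>, where \<open>x\<close> and \<open>z\<close> are the coordinates
  of \<open>c\<close> and \<open>d\<close>.\<close>

definition jac :: "('a, 'n::finite) chart \<Rightarrow> ('a, 'n) chart \<Rightarrow> 'n \<Rightarrow> 'n \<Rightarrow> real^'n \<Rightarrow> real" where
  "jac c d k a = pd a (\<lambda>x. transition c d x $ k)"

definition hess :: "('a, 'n::finite) chart \<Rightarrow> ('a, 'n) chart \<Rightarrow> 'n \<Rightarrow> 'n \<Rightarrow> 'n \<Rightarrow> real^'n \<Rightarrow> real" where
  "hess c d k a b = pd a (pd b (\<lambda>x. transition c d x $ k))"

text \<open>\<open>N c k i\<close> is the component \<open>N\<^sub>i\<^sup>k\<close> in the chart \<open>c\<close>; only its values on \<open>slit_coords c\<close>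
  are meaningful.\<close>

type_synonym ('a, 'n) nlconn = "('a, 'n) chart \<Rightarrow> 'n \<Rightarrow> 'n \<Rightarrow> 'n cfun"

definition homog_nonlinear_connection ::
  "('a, 'n::finite) chart set \<Rightarrow> ('a, 'n) nlconn \<Rightarrow> bool" where
  "homog_nonlinear_connection \<A> N \<longleftrightarrow>
     (\<forall>c\<in>\<A>. \<forall>k i. smooth_cfun c (N c k i) \<and> homog_cfun 1 c (N c k i)) \<and>
     (\<forall>c\<in>\<A>. \<forall>d\<in>\<A>. \<forall>p\<in>fst c \<inter> fst d. \<forall>y. y \<noteq> 0 \<longrightarrow>
        (let x = snd c p; z = snd d p; w = (\<chi> b. \<Sum>a\<in>UNIV. jac c d b a x * y $ a) in
         \<forall>k i. N d k i z w =
           (\<Sum>e\<in>UNIV. \<Sum>b\<in>UNIV. jac c d k e x * hess d c e i b z * w $ b) +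
           (\<Sum>e\<in>UNIV. \<Sum>a\<in>UNIV. jac c d k e x * jac d c a i z * N c e a x y)))"

definition symmetric_connection :: "('a, 'n::finite) chart set \<Rightarrow> ('a, 'n) nlconn \<Rightarrow> bool" where
  "symmetric_connection \<A> N \<longleftrightarrow>
     (\<forall>c\<in>\<A>. \<forall>(x, y)\<in>slit_coords c. \<forall>k i j. dy j (N c k i) x y = dy i (N c k j) x y)"


section \<open>Objects determined by a pseudo-Finsler metric, in coordinates\<close>

text \<open>Here \<open>l\<close> is the coordinate expression of \<open>L\<close> in a chart. The definitions make sense as
  intended when \<open>l\<close> is smooth with non-degenerate \<open>gf l\<close>.\<close>

definition gf :: "('n::finite) cfun \<Rightarrow> 'n \<Rightarrow> 'n \<Rightarrow> 'n cfun" where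
  "gf l i j x y = 1/2 * dy j (dy i l) x y"

definition gf_inv :: "('n::finite) cfun \<Rightarrow> 'n \<Rightarrow> 'n \<Rightarrow> 'n cfun" where
  "gf_inv l i j x y = matrix_inv (\<chi> a b. gf l a b x y) $ i $ j"

definition y_low :: "('n::finite) cfun \<Rightarrow> 'n \<Rightarrow> 'n cfun" where
  "y_low l i x y = (\<Sum>a\<in>UNIV. gf l i a x y * y $ a)"

definition spray :: "('n::finite) cfun \<Rightarrow> 'n \<Rightarrow> 'n cfun" where
  "spray l i x y = 1/4 * (\<Sum>a\<in>UNIV. \<Sum>b\<in>UNIV. \<Sum>c\<in>UNIV.
     gf_inv l i a x y * (2 * dx c (gf l a b) x y - dx a (gf l b c) x y) * y $ b * y $ c)"

definition NL :: "('n::finite) cfun \<Rightarrow> 'n \<Rightarrow> 'n \<Rightarrow> 'n cfun" where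
  "NL l k i = dy i (spray l k)"

definition cartan :: "('n::finite) cfun \<Rightarrow> 'n \<Rightarrow> 'n \<Rightarrow> 'n \<Rightarrow> 'n cfun" where
  "cartan l i j k x y = 1/2 * dy k (gf l i j) x y"

definition mean_cartan :: "('n::finite) cfun \<Rightarrow> 'n \<Rightarrow> 'n cfun" where
  "mean_cartan l i x y = (\<Sum>a\<in>UNIV. \<Sum>b\<in>UNIV. gf_inv l a b x y * cartan l a b i x y)"

definition landsberg :: "('n::finite) cfun \<Rightarrow> 'n \<Rightarrow> 'n \<Rightarrow> 'n \<Rightarrow> 'n cfun" where
  "landsberg l i j k x y = 1/2 *
     (dx k (gf l i j) x y - (\<Sum>a\<in>UNIV. NL l a k x y * dy a (gf l i j) x y)
      - (\<Sum>a\<in>UNIV. dy i (NL l a k) x y * gf l a j x y)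
      - (\<Sum>a\<in>UNIV. dy j (NL l a k) x y * gf l i a x y))"

definition mean_landsberg :: "('n::finite) cfun \<Rightarrow> 'n \<Rightarrow> 'n cfun" where
  "mean_landsberg l i x y = (\<Sum>a\<in>UNIV. \<Sum>b\<in>UNIV. gf_inv l a b x y * landsberg l a b i x y)"

text \<open>The factor in braces and the left-hand side of the affine equation, where \<open>J k i\<close> is
  \<open>J\<^sup>k\<^sub>i\<close>.\<close>

definition affine_covector :: "('n::finite) cfun \<Rightarrow> ('n \<Rightarrow> 'n \<Rightarrow> 'n cfun) \<Rightarrow> 'n \<Rightarrow> 'n cfun" where
  "affine_covector l J b x y =
     2 * mean_landsberg l b x y
     + (real CARD('n) + 2) * (\<Sum>a\<in>UNIV. y_low l a x y / l x y * J a b x y)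
     - 2 * (\<Sum>a\<in>UNIV. mean_cartan l a x y * J a b x y)
     - (\<Sum>a\<in>UNIV. dy a (J a b) x y + dy b (J a a) x y)"

definition affine_lhs :: "('n::finite) cfun \<Rightarrow> ('n \<Rightarrow> 'n \<Rightarrow> 'n cfun) \<Rightarrow> 'n \<Rightarrow> 'n \<Rightarrow> 'n cfun" where
  "affine_lhs l J i j x y =
     (\<Sum>b\<in>UNIV. affine_covector l J b x y *
        ((if b = i then 1 else 0) * y $ j - y $ b * (if j = i then 1 else 0)))
     - (\<Sum>a\<in>UNIV. (dy a (J j i) x y - dy i (J j a) x y) * y $ a)"


section \<open>Solutions of the affine equation\<close>

definition metric_connection ::
  "('a, 'n::finite) chart set \<Rightarrow> ('a \<times> ('a, 'n) tvec \<Rightarrow> real) \<Rightarrow> ('a, 'n) nlconn" where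
  "metric_connection \<A> L c k i = NL (local_rep \<A> L c) k i"

definition solves_affine_equation ::
  "'a topology \<Rightarrow> ('a, 'n::finite) chart set \<Rightarrow> ('a \<times> ('a, 'n) tvec \<Rightarrow> real) \<Rightarrow> ('a, 'n) nlconn \<Rightarrow> bool" where
  "solves_affine_equation X \<A> L N \<longleftrightarrow>
     homog_nonlinear_connection \<A> N \<and>
     (\<exists>J. homog_tensor11 1 X \<A> J \<and>
        (\<forall>c\<in>\<A>. \<forall>(x, y)\<in>slit_coords c.
           (\<forall>k i. N c k i x y = metric_connection \<A> L c k i x y + comp11 \<A> J c k i x y) \<and>
           (\<forall>i j. affine_lhs (local_rep \<A> L c) (comp11 \<A> J c) i j x y = 0)))"

end

theory Submission
  imports Defs
begin

text \<open>
\<^bold>\<open>Uniqueness.\<close> Let \<open>J\<close> be the difference of a symmetric solution and \<open>N\<^sup>L\<close>. For a Riemannian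
metric the mean Cartan and Landsberg tensors vanish, and symmetry of \<open>J\<close> removes the last term of the
affine equation. What remains has the form \<open>V\<^sub>i y\<^sup>j = V\<^sub>b y\<^sup>b \<delta>\<^sup>j\<^sub>i\<close>,
which forces \<open>V = 0\<close>. With the trace \<open>f = J\<^sup>a\<^sub>a\<close>, this is the system
\<open>(n + 2) y\<^sub>a J\<^sup>a\<^sub>b = 2 L f\<^sub>\<cdot>\<^sub>b\<close> on a single tangent space with its constant scalar
product. Symmetry and homogeneity make \<open>J\<^sup>a\<^sub>b\<close> half the vertical derivative of
\<open>w\<^sup>a = J\<^sup>a\<^sub>b y\<^sup>b\<close>. Contracting the system with \<open>y\<close> and differentiating again expresses \<open>w\<close>,
hence \<open>J\<close>, through \<open>f\<close> and its derivatives: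
\<open>(n + 2) w\<^sup>a = 4 f y\<^sup>a - 2 L f\<^sup>\<cdot>\<^sup>a\<close>. The divergence of this identity is
\<open>L \<Delta>f = (n - 2) f\<close>. As \<open>f\<close> is 1-homogeneous, its restriction to the unit sphere
satisfies \<open>\<Delta>\<^sub>S f = - f\<close> for the spherical Laplacian. For \<open>n \<ge> 3\<close> the number \<open>1\<close> lies strictly
between the first two eigenvalues \<open>0\<close> and \<open>n - 1\<close> of \<open>- \<Delta>\<^sub>S\<close>, so \<open>f = 0\<close> and then \<open>J = 0\<close>
(\<open>symmetric_solution.J_eq_0\<close>).

The eigenvalue gap (\<open>sphere_eigenfunction.eq_0\<close>) follows from a maximum principle and uses neither
integration over the sphere nor spherical harmonics. The difference of \<open>f\<close> and its mirror image in a
hyperplane solves the same equation and vanishes on the equator. An explicit positive strict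
supersolution on the closed hemisphere shows that it vanishes. Hence \<open>f\<close> is invariant under all
reflections, so it is constant on the sphere, and the equation excludes nonzero constants.

\<^bold>\<open>Existence.\<close> \<open>N\<^sup>L\<close> solves the equation with \<open>J = 0\<close>, because its Landsberg tensor, half the
covariant derivative of the metric with respect to the Levi-Civita connection, vanishes. The remaining work is to show that
\<open>N\<^sup>L\<close> is a nonlinear connection, in particular that the Christoffel symbols have the right
transformation law. This is deduced from the uniqueness of the symmetric metric connection
(\<open>levi_civita_unique\<close>, \<open>christoffel_transformation\<close>): the symbols prescribed by the transformation
law are symmetric and compatible with the transformed metric.
\<close>

section \<open>Calculus of smooth functions\<close>

lemma Ck_on_cong:
  assumes "open S" "\<And>x. x \<in> S \<Longrightarrow> f x = g x"
  shows "Ck_on k S f \<longleftrightarrow> Ck_on k S g"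
  using assms
proof (induction k arbitrary: f g)
  case 0
  then show ?case by (simp cong: continuous_on_cong)
next
  case (Suc k)
  have d: "f differentiable (at x) \<longleftrightarrow> g differentiable (at x)" if "x \<in> S" for x
    unfolding differentiable_def
    using has_derivative_transform_within_open[OF _ Suc.prems(1) that] Suc.prems(2) by metis
  have e: "frechet_derivative f (at x) = frechet_derivative g (at x)" if "x \<in> S" for x
    unfolding frechet_derivative_def
    using has_derivative_transform_within_open[OF _ Suc.prems(1) that] Suc.prems(2) by metis
  have "Ck_on k S (\<lambda>x. frechet_derivative f (at x) v) \<longleftrightarrow> Ck_on k S (\<lambda>x. frechet_derivative g (at x) v)" for v
    by (rule Suc.IH) (use Suc.prems e in auto)
  then show ?case using d by simp
qed

lemma Ck_on_SucI:
  assumes "open S" "\<And>x. x \<in> S \<Longrightarrow> (f has_derivative f' x) (at x)"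
    and "\<And>v. Ck_on k S (\<lambda>x. f' x v)"
  shows "Ck_on (Suc k) S f"
proof -
  have "Ck_on k S (\<lambda>x. frechet_derivative f (at x) v) \<longleftrightarrow> Ck_on k S (\<lambda>x. f' x v)" for v
    by (rule Ck_on_cong[OF assms(1)]) (use assms(2) frechet_derivative_at in metis)
  then show ?thesis using assms(2,3) by (auto simp: differentiable_def)
qed

lemma Ck_on_Suc_has_derivative:
  "Ck_on (Suc k) S f \<Longrightarrow> x \<in> S \<Longrightarrow> (f has_derivative frechet_derivative f (at x)) (at x)"
  by (simp add: frechet_derivative_works)

lemma Ck_on_Suc_imp: "Ck_on (Suc k) S f \<Longrightarrow> Ck_on k S f"
proof (induction k arbitrary: f)
  case 0
  then show ?case
    by (auto intro!: continuous_at_imp_continuous_on differentiable_imp_continuous_within)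
next
  case (Suc k)
  then show ?case by (metis Ck_on.simps(2))
qed

lemma Ck_on_const: "open S \<Longrightarrow> Ck_on k S (\<lambda>x. c)"
proof (induction k arbitrary: c)
  case (Suc k)
  show ?case by (rule Ck_on_SucI[where f' = "\<lambda>_ _. 0"]) (use Suc in auto)
qed simp

lemma Ck_on_bounded_linear_compose:
  assumes "open S" "bounded_linear l" "Ck_on k S f"
  shows "Ck_on k S (\<lambda>x. l (f x))"
  using assms(3)
proof (induction k arbitrary: f)
  case 0
  then show ?case using assms(2) by (simp add: bounded_linear.continuous_on)
next
  case (Suc k)
  show ?case
  proof (rule Ck_on_SucI[OF assms(1)])
    show "((\<lambda>x. l (f x)) has_derivative (\<lambda>v. l (frechet_derivative f (at x) v))) (at x)"
      if "x \<in> S" for x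
      by (rule bounded_linear.has_derivative[OF assms(2) Ck_on_Suc_has_derivative[OF Suc.prems that]])
    show "Ck_on k S (\<lambda>x. l (frechet_derivative f (at x) v))" for v
      using Suc by simp
  qed
qed

text \<open>Composition with affine maps covers the two ways in which functions on \<open>M\<close> and on \<open>TM\<close> are
  related in coordinates: the projection \<open>(x, y) \<mapsto> x\<close> and the inclusion \<open>y \<mapsto> (x, y)\<close> of a
  tangent space.\<close>

lemma Ck_on_compose_affine:
  assumes "open T" "bounded_linear l" "\<And>x. x \<in> T \<Longrightarrow> z + l x \<in> S" "Ck_on k S f"
  shows "Ck_on k T (\<lambda>x. f (z + l x))"
  using assms(4)
proof (induction k arbitrary: f)
  case 0
  have "continuous_on T (\<lambda>x. z + l x)"
    by (intro continuous_on_add continuous_on_const linear_continuous_on assms(2))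
  then show ?case
    using continuous_on_compose2[of S f T "\<lambda>x. z + l x"] 0 assms(3) by auto
next
  case (Suc k)
  show ?case
  proof (rule Ck_on_SucI[OF assms(1)])
    show "((\<lambda>x. f (z + l x)) has_derivative (\<lambda>v. frechet_derivative f (at (z + l x)) (l v))) (at x)"
      if "x \<in> T" for x
    proof -
      have "((\<lambda>x. z + l x) has_derivative l) (at x)"
        using bounded_linear_imp_has_derivative[OF assms(2)] by (auto intro!: derivative_eq_intros)
      then show ?thesis
        using Ck_on_Suc_has_derivative[OF Suc.prems assms(3)[OF that]]
        by (rule has_derivative_compose)
    qed
    show "Ck_on k T (\<lambda>x. frechet_derivative f (at (z + l x)) (l v))" for v
      by (rule Suc.IH) (use Suc.prems in simp)
  qed
qed

lemma Ck_on_add: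
  assumes "open S" "Ck_on k S f" "Ck_on k S g"
  shows "Ck_on k S (\<lambda>x. f x + g x)"
  using assms(2,3)
proof (induction k arbitrary: f g)
  case 0
  then show ?case by (simp add: continuous_on_add)
next
  case (Suc k)
  show ?case
  proof (rule Ck_on_SucI[OF assms(1)])
    show "((\<lambda>x. f x + g x) has_derivative
        (\<lambda>v. frechet_derivative f (at x) v + frechet_derivative g (at x) v)) (at x)"
      if "x \<in> S" for x
      using Ck_on_Suc_has_derivative[OF Suc.prems(1) that] Ck_on_Suc_has_derivative[OF Suc.prems(2) that]
      by (rule has_derivative_add)
    show "Ck_on k S (\<lambda>x. frechet_derivative f (at x) v + frechet_derivative g (at x) v)" for v
      using Suc by simp
  qed
qed

lemma Ck_on_mult:
  fixes f g :: "'a::euclidean_space \<Rightarrow> real"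
  assumes "open S" "Ck_on k S f" "Ck_on k S g"
  shows "Ck_on k S (\<lambda>x. f x * g x)"
  using assms(2,3)
proof (induction k arbitrary: f g)
  case 0
  then show ?case by (simp add: continuous_on_mult)
next
  case (Suc k)
  show ?case
  proof (rule Ck_on_SucI[OF assms(1)])
    show "((\<lambda>x. f x * g x) has_derivative
        (\<lambda>v. f x * frechet_derivative g (at x) v + frechet_derivative f (at x) v * g x)) (at x)"
      if "x \<in> S" for x
      using Ck_on_Suc_has_derivative[OF Suc.prems(1) that] Ck_on_Suc_has_derivative[OF Suc.prems(2) that]
      by (rule has_derivative_mult)
    show "Ck_on k S (\<lambda>x. f x * frechet_derivative g (at x) v + frechet_derivative f (at x) v * g x)" for v
      by (intro Ck_on_add[OF assms(1)] Suc.IH Ck_on_Suc_imp[OF Suc.prems(1)] Ck_on_Suc_imp[OF Suc.prems(2)])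
        (use Suc.prems in simp_all)
  qed
qed

lemma Ck_on_inverse:
  fixes f :: "'a::euclidean_space \<Rightarrow> real"
  assumes "open S" "Ck_on k S f" "\<And>x. x \<in> S \<Longrightarrow> f x \<noteq> 0"
  shows "Ck_on k S (\<lambda>x. inverse (f x))"
  using assms(2)
proof (induction k)
  case 0
  then show ?case using assms(3) by (simp add: continuous_on_inverse)
next
  case (Suc k)
  show ?case
  proof (rule Ck_on_SucI[OF assms(1)])
    show "((\<lambda>x. inverse (f x)) has_derivative
        (\<lambda>v. (-1) * (inverse (f x) * frechet_derivative f (at x) v * inverse (f x)))) (at x)"
      if "x \<in> S" for x
      using Deriv.has_derivative_inverse[OF assms(3)[OF that] Ck_on_Suc_has_derivative[OF Suc.prems(1) that]]
      by simp
    have "Ck_on k S (\<lambda>x. inverse (f x))"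
      using Suc.IH Ck_on_Suc_imp[OF Suc.prems] by blast
    then show "Ck_on k S (\<lambda>x. (-1) * (inverse (f x) * frechet_derivative f (at x) v * inverse (f x)))" for v
      by (intro Ck_on_mult[OF assms(1)] Ck_on_const[OF assms(1)]) (use Suc.prems in simp_all)
  qed
qed

lemma smooth_on_cong: "open S \<Longrightarrow> (\<And>x. x \<in> S \<Longrightarrow> f x = g x) \<Longrightarrow> smooth_on S f \<longleftrightarrow> smooth_on S g"
  unfolding smooth_on_def using Ck_on_cong by blast

lemma smooth_on_const: "open S \<Longrightarrow> smooth_on S (\<lambda>x. c)"
  by (simp add: smooth_on_def Ck_on_const)

lemma smooth_on_bounded_linear_compose:
  "open S \<Longrightarrow> bounded_linear l \<Longrightarrow> smooth_on S f \<Longrightarrow> smooth_on S (\<lambda>x. l (f x))"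
  by (simp add: smooth_on_def Ck_on_bounded_linear_compose)

lemma smooth_on_compose_affine:
  assumes "open T" "bounded_linear l" "\<And>x. x \<in> T \<Longrightarrow> z + l x \<in> S" "smooth_on S f"
  shows "smooth_on T (\<lambda>x. f (z + l x))"
  using assms unfolding smooth_on_def by (blast intro: Ck_on_compose_affine)

lemma smooth_on_add: "open S \<Longrightarrow> smooth_on S f \<Longrightarrow> smooth_on S g \<Longrightarrow> smooth_on S (\<lambda>x. f x + g x)"
  by (simp add: smooth_on_def Ck_on_add)

lemma Ck_on_bounded_linear:
  assumes "open S" "bounded_linear l" shows "Ck_on k S l"
proof (cases k)
  case 0
  then show ?thesis using linear_continuous_on[OF assms(2)] by simp
next
  case (Suc k')
  show ?thesis unfolding Suc
    by (rule Ck_on_SucI[OF assms(1), of _ "\<lambda>_. l"])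
      (use assms in \<open>auto intro: bounded_linear_imp_has_derivative Ck_on_const\<close>)
qed

lemma smooth_on_bounded_linear: "open S \<Longrightarrow> bounded_linear l \<Longrightarrow> smooth_on S l"
  by (simp add: smooth_on_def Ck_on_bounded_linear)

lemma smooth_on_mult:
  fixes f g :: "'a::euclidean_space \<Rightarrow> real"
  shows "open S \<Longrightarrow> smooth_on S f \<Longrightarrow> smooth_on S g \<Longrightarrow> smooth_on S (\<lambda>x. f x * g x)"
  by (simp add: smooth_on_def Ck_on_mult)

lemma smooth_on_divide:
  fixes f g :: "'a::euclidean_space \<Rightarrow> real"
  shows "open S \<Longrightarrow> smooth_on S f \<Longrightarrow> smooth_on S g \<Longrightarrow> (\<And>x. x \<in> S \<Longrightarrow> g x \<noteq> 0)
    \<Longrightarrow> smooth_on S (\<lambda>x. f x / g x)"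
  by (simp add: smooth_on_def divide_inverse Ck_on_mult Ck_on_inverse)

lemma smooth_on_diff:
  fixes f g :: "'a::euclidean_space \<Rightarrow> real"
  assumes "open S" "smooth_on S f" "smooth_on S g" shows "smooth_on S (\<lambda>x. f x - g x)"
  using smooth_on_add[OF assms(1,2) smooth_on_mult[OF assms(1) smooth_on_const[OF assms(1), of "-1"] assms(3)]]
  by simp

lemma smooth_on_sum:
  assumes "open S" "\<And>i. i \<in> I \<Longrightarrow> smooth_on S (f i)"
  shows "smooth_on S (\<lambda>x. \<Sum>i\<in>I. f i x)"
  using assms
proof (induction I rule: infinite_finite_induct)
qed (auto simp: smooth_on_const intro: smooth_on_add)

lemma smooth_on_prod:
  fixes f :: "'i \<Rightarrow> 'a::euclidean_space \<Rightarrow> real"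
  assumes "open S" "\<And>i. i \<in> I \<Longrightarrow> smooth_on S (f i)"
  shows "smooth_on S (\<lambda>x. \<Prod>i\<in>I. f i x)"
  using assms
proof (induction I rule: infinite_finite_induct)
qed (auto simp: smooth_on_const intro: smooth_on_mult)

lemma smooth_on_has_derivative:
  "smooth_on S f \<Longrightarrow> x \<in> S \<Longrightarrow> (f has_derivative frechet_derivative f (at x)) (at x)"
  unfolding smooth_on_def using Ck_on_Suc_has_derivative by blast

lemma smooth_on_frechet_derivative:
  "smooth_on S f \<Longrightarrow> smooth_on S (\<lambda>x. frechet_derivative f (at x) v)"
  unfolding smooth_on_def using Ck_on.simps(2) by blast

lemma smooth_on_pd: "smooth_on S f \<Longrightarrow> smooth_on S (pd i f)"
  unfolding pd_def by (rule smooth_on_frechet_derivative)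

lemma smooth_on_continuous: "smooth_on S f \<Longrightarrow> continuous_on S f"
  unfolding smooth_on_def by (metis Ck_on.simps(1))

lemma matrix_inv_inverse:
  fixes A :: "real^'n^'n"
  assumes "invertible A"
  shows "A ** matrix_inv A = mat 1" "matrix_inv A ** A = mat 1"
  using someI_ex[OF assms[unfolded invertible_def]] by (simp_all add: matrix_inv_def)

text \<open>Cramer's rule writes the entries of the inverse as quotients of determinants, which are
  polynomials in the entries of the matrix.\<close>

lemma smooth_on_matrix_inv:
  fixes A :: "'n::finite \<Rightarrow> 'n \<Rightarrow> 'a::euclidean_space \<Rightarrow> real"
  assumes "open S" "\<And>i j. smooth_on S (A i j)" and inv: "\<And>x. x \<in> S \<Longrightarrow> invertible (\<chi> i j. A i j x)"
  shows "smooth_on S (\<lambda>x. matrix_inv (\<chi> i j. A i j x) $ i $ j)"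
proof -
  have det: "smooth_on S (\<lambda>x. det (\<chi> i j. B i j x))"
    if "\<And>i j. smooth_on S (B i j)" for B :: "'n \<Rightarrow> 'n \<Rightarrow> 'a \<Rightarrow> real"
    unfolding det_def
    by (simp, intro smooth_on_sum smooth_on_mult smooth_on_prod smooth_on_const that assms(1))
  have eq: "matrix_inv (\<chi> i j. A i j x) $ i $ j =
      det (\<chi> r c. if c = i then axis j 1 $ r else A r c x) / det (\<chi> i j. A i j x)" if "x \<in> S" for x
  proof -
    let ?M = "\<chi> i j. A i j x"
    have i: "invertible ?M" using inv that .
    then have d: "det ?M \<noteq> 0" by (simp add: invertible_det_nz)
    have "?M *v (matrix_inv ?M *v axis j 1) = axis j 1"
      by (simp add: matrix_vector_mul_assoc matrix_inv_inverse(1)[OF i])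
    then have e: "matrix_inv ?M *v axis j 1 =
      (\<chi> k. det (\<chi> r c. if c = k then axis j 1 $ r else ?M $ r $ c) / det ?M)"
      using cramer[OF d] by blast
    have "(matrix_inv ?M *v axis j 1) $ i = matrix_inv ?M $ i $ j"
      by (simp add: matrix_vector_mul_component inner_axis)
    then show ?thesis using e by (simp cong: if_cong)
  qed
  have "smooth_on S (\<lambda>x. det (\<chi> r c. if c = i then axis j 1 $ r else A r c x) / det (\<chi> i j. A i j x))"
  proof (rule smooth_on_divide[OF assms(1) det det])
    show "smooth_on S (\<lambda>x. if c = i then axis j 1 $ r else A r c x)" for r c
      by (cases "c = i") (simp_all add: assms smooth_on_const)
  qed (use assms inv invertible_det_nz in auto)
  then show ?thesis using smooth_on_cong[OF assms(1) eq] by simp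
qed

text \<open>Symmetry of the second derivative: two applications of the mean value theorem to the second
  difference of \<open>f\<close> over a small parallelogram, in the two possible orders, produce points near
  \<open>x\<close> at which the two iterated derivatives agree.\<close>

lemma second_derivative_symmetric:
  fixes f :: "'a::euclidean_space \<Rightarrow> real"
  assumes "open S" "x \<in> S" "smooth_on S f"
  defines "D \<equiv> \<lambda>v w z. frechet_derivative (\<lambda>z. frechet_derivative f (at z) v) (at z) w"
  shows "D v w x = D w v x"
proof -
  let ?D1 = "\<lambda>v z. frechet_derivative f (at z) v"
  have c: "continuous_on S (D v w)" for v w
    unfolding D_def by (intro smooth_on_continuous smooth_on_frechet_derivative assms)
  have pts: "\<exists>p. p \<in> ball x e \<and> (\<exists>q \<in> ball x e. D v w p = D w v q)"
    if "e > 0" "ball x e \<subseteq> S" for e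
  proof -
    \<comment> \<open>the side length for which the parallelogram stays in the ball\<close>
    define h where "h = e / (2 * (norm v + norm w + 1))"
    have h0: "h > 0" unfolding h_def using that by (auto intro!: divide_pos_pos add_nonneg_pos)
    have hb: "h * (norm v + norm w) < e"
    proof -
      have "norm v + norm w + 1 > 0" by (auto intro!: add_nonneg_pos)
      then have "h * (norm v + norm w + 1) = e / 2" unfolding h_def by (simp add: field_simps)
      then have "h * (norm v + norm w) + h = e / 2" by (simp add: algebra_simps)
      then show ?thesis using that h0 by linarith
    qed
    have inb: "x + s *\<^sub>R v + t *\<^sub>R w \<in> ball x e" if "0 \<le> s" "s \<le> h" "0 \<le> t" "t \<le> h" for s t
    proof -
      have "norm (s *\<^sub>R v + t *\<^sub>R w) \<le> s * norm v + t * norm w"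
        by (rule norm_triangle_le) (use that in simp)
      also have "\<dots> \<le> h * norm v + h * norm w"
        by (intro add_mono mult_right_mono) (use that in auto)
      also have "\<dots> < e" using hb by (simp add: algebra_simps)
      finally have "norm (s *\<^sub>R v + t *\<^sub>R w) < e" .
      moreover have "dist x (x + s *\<^sub>R v + t *\<^sub>R w) = norm (s *\<^sub>R v + t *\<^sub>R w)"
        by (metis add.assoc add_diff_cancel_left' dist_commute dist_norm)
      ultimately show ?thesis by simp
    qed
    have line: "((\<lambda>t. F (a + t *\<^sub>R u)) has_real_derivative frechet_derivative F (at (a + t *\<^sub>R u)) u) (at t)"
      if "smooth_on S F" "a + t *\<^sub>R u \<in> S" for F :: "'a \<Rightarrow> real" and a u t
    proof -
      have d: "(F has_derivative frechet_derivative F (at (a + t *\<^sub>R u))) (at (a + t *\<^sub>R u))"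
        using smooth_on_has_derivative[OF that] .
      have "((\<lambda>t. F (a + t *\<^sub>R u)) has_derivative (\<lambda>s. frechet_derivative F (at (a + t *\<^sub>R u)) (s *\<^sub>R u))) (at t)"
        by (rule has_derivative_compose[where f = "\<lambda>t. a + t *\<^sub>R u" and g = F, OF _ d]) (auto intro!: derivative_eq_intros)
      moreover have "linear (frechet_derivative F (at (a + t *\<^sub>R u)))"
        using d has_derivative_linear by blast
      ultimately show ?thesis
        by (simp add: has_field_derivative_def linear_cmul mult_commute_abs)
    qed
    have key: "\<exists>p \<in> ball x e. f (x + h *\<^sub>R v' + h *\<^sub>R w') - f (x + h *\<^sub>R v') - f (x + h *\<^sub>R w') + f x
        = h * h * D v' w' p"
      if inb': "\<And>s t. 0 \<le> s \<Longrightarrow> s \<le> h \<Longrightarrow> 0 \<le> t \<Longrightarrow> t \<le> h \<Longrightarrow> x + s *\<^sub>R v' + t *\<^sub>R w' \<in> ball x e" for v' w'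
    proof -
      have inS: "x + s *\<^sub>R v' + t *\<^sub>R w' \<in> S" if "0 \<le> s" "s \<le> h" "0 \<le> t" "t \<le> h" for s t
        using inb'[OF that] \<open>ball x e \<subseteq> S\<close> by blast
      have comm: "x + s *\<^sub>R v' + t *\<^sub>R w' = (x + t *\<^sub>R w') + s *\<^sub>R v'" for s t by simp
      have "\<exists>z. 0 < z \<and> z < h \<and>
        (f (x + h *\<^sub>R w' + h *\<^sub>R v') - f (x + h *\<^sub>R v')) - (f (x + h *\<^sub>R w' + 0 *\<^sub>R v') - f (x + 0 *\<^sub>R v'))
          = (h - 0) * (?D1 v' (x + h *\<^sub>R w' + z *\<^sub>R v') - ?D1 v' (x + z *\<^sub>R v'))"
      proof (rule MVT2[OF h0])
        fix s assume s: "0 \<le> s" "s \<le> h"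
        have "x + h *\<^sub>R w' + s *\<^sub>R v' \<in> S" using inS[of s h] s h0 comm by simp
        moreover have "x + s *\<^sub>R v' \<in> S" using inS[of s 0] s h0 by simp
        ultimately show "((\<lambda>s. f (x + h *\<^sub>R w' + s *\<^sub>R v') - f (x + s *\<^sub>R v')) has_real_derivative
           ?D1 v' (x + h *\<^sub>R w' + s *\<^sub>R v') - ?D1 v' (x + s *\<^sub>R v')) (at s)"
          by (intro DERIV_diff line assms(3))
      qed
      then obtain s where s: "0 < s" "s < h" and e1:
        "f (x + h *\<^sub>R v' + h *\<^sub>R w') - f (x + h *\<^sub>R v') - f (x + h *\<^sub>R w') + f x
          = h * (?D1 v' (x + s *\<^sub>R v' + h *\<^sub>R w') - ?D1 v' (x + s *\<^sub>R v'))"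
        by (auto simp: algebra_simps)
      have "\<exists>t. 0 < t \<and> t < h \<and> ?D1 v' (x + s *\<^sub>R v' + h *\<^sub>R w') - ?D1 v' (x + s *\<^sub>R v' + 0 *\<^sub>R w')
          = (h - 0) * D v' w' (x + s *\<^sub>R v' + t *\<^sub>R w')"
      proof (rule MVT2[OF h0])
        fix t assume "0 \<le> t" "t \<le> h"
        then have "x + s *\<^sub>R v' + t *\<^sub>R w' \<in> S" using inS s by simp
        then show "((\<lambda>t. ?D1 v' (x + s *\<^sub>R v' + t *\<^sub>R w')) has_real_derivative D v' w' (x + s *\<^sub>R v' + t *\<^sub>R w')) (at t)"
          unfolding D_def by (intro line smooth_on_frechet_derivative assms(3))
      qed
      then obtain t where t: "0 < t" "t < h" and e2: "?D1 v' (x + s *\<^sub>R v' + h *\<^sub>R w') - ?D1 v' (x + s *\<^sub>R v')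
          = h * D v' w' (x + s *\<^sub>R v' + t *\<^sub>R w')" by auto
      show ?thesis
        using inb'[of s t] s t e1 e2 by (intro bexI[of _ "x + s *\<^sub>R v' + t *\<^sub>R w'"]) auto
    qed
    obtain p where p: "p \<in> ball x e"
      "f (x + h *\<^sub>R v + h *\<^sub>R w) - f (x + h *\<^sub>R v) - f (x + h *\<^sub>R w) + f x = h * h * D v w p"
      using key[OF inb] by blast
    have inb2: "x + s *\<^sub>R w + t *\<^sub>R v \<in> ball x e" if "0 \<le> s" "s \<le> h" "0 \<le> t" "t \<le> h" for s t
      using inb[of t s] that by (simp add: add_ac)
    obtain q where q: "q \<in> ball x e"
      "f (x + h *\<^sub>R w + h *\<^sub>R v) - f (x + h *\<^sub>R w) - f (x + h *\<^sub>R v) + f x = h * h * D w v q"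
      using key[OF inb2] by blast
    have "h * h * D v w p = h * h * D w v q" using p(2) q(2) by (simp add: algebra_simps)
    then have "D v w p = D w v q" using h0 by simp
    then show ?thesis using p(1) q(1) by blast
  qed
  show ?thesis
  proof (rule ccontr)
    assume ne: "D v w x \<noteq> D w v x"
    define m where "m = \<bar>D v w x - D w v x\<bar> / 2"
    have m: "m > 0" using ne by (simp add: m_def)
    have nb: "\<exists>d>0. \<forall>p\<in>ball x d. p \<in> S \<longrightarrow> \<bar>D a b p - D a b x\<bar> < m" for a b
      using c[of a b] m assms(2) unfolding continuous_on_iff
      by (metis dist_commute dist_real_def mem_ball)
    obtain d1 where d1: "d1 > 0" "\<forall>p\<in>ball x d1. p \<in> S \<longrightarrow> \<bar>D v w p - D v w x\<bar> < m" using nb by blast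
    obtain d2 where d2: "d2 > 0" "\<forall>p\<in>ball x d2. p \<in> S \<longrightarrow> \<bar>D w v p - D w v x\<bar> < m" using nb by blast
    obtain d3 where d3: "d3 > 0" "ball x d3 \<subseteq> S" using assms(1,2) open_contains_ball by blast
    define e where "e = min d1 (min d2 d3)"
    have e: "e > 0" "ball x e \<subseteq> S" using d1 d2 d3 by (auto simp: e_def)
    obtain p q where pq: "p \<in> ball x e" "q \<in> ball x e" "D v w p = D w v q"
      using pts[OF e] by blast
    have "p \<in> ball x d1 \<inter> S" "q \<in> ball x d2 \<inter> S" using pq e by (auto simp: e_def)
    then have "\<bar>D v w p - D v w x\<bar> < m" "\<bar>D w v q - D w v x\<bar> < m" using d1(2) d2(2) by blast+
    moreover have "\<bar>D v w x - D w v x\<bar> = 2 * m" by (simp add: m_def)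
    ultimately show False using pq(3) by linarith
  qed
qed

section \<open>An eigenvalue gap on the sphere\<close>

lemma second_derivative_nonpos_at_max:
  fixes u :: "real \<Rightarrow> real"
  assumes "\<delta> > 0" "\<And>s. \<bar>s\<bar> < \<delta> \<Longrightarrow> (u has_real_derivative u' s) (at s)"
    "(u' has_real_derivative c) (at 0)" "\<And>s. \<bar>s\<bar> < \<delta> \<Longrightarrow> u s \<le> u 0"
  shows "c \<le> 0"
proof (rule ccontr)
  assume "\<not> c \<le> 0"
  then have "c > 0" by simp
  have u0: "u' 0 = 0"
    by (rule DERIV_local_max[OF assms(2)[of 0] assms(1)]) (use assms in auto)
  obtain d where d: "d > 0" "\<And>h. h > 0 \<Longrightarrow> h < d \<Longrightarrow> u' 0 < u' (0 + h)"
    using DERIV_pos_inc_right[OF assms(3) \<open>c > 0\<close>] by blast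
  define h where "h = min d \<delta> / 2"
  have h: "0 < h" "h < d" "h < \<delta>" using d(1) assms(1) by (auto simp: h_def)
  obtain z where z: "0 < z" "z < h" "u h - u 0 = (h - 0) * u' z"
    using MVT2[of 0 h u u'] h assms(2) by force
  have "u' z > 0" using d(2)[of z] z h u0 by simp
  then have "u h > u 0" using z h by (metis diff_gt_0_iff_gt diff_zero mult_pos_pos)
  then show False using assms(4)[of h] h by simp
qed

text \<open>The function \<open>r + 2nt - t\<^sup>2/r\<close>, where \<open>r = |y|\<close> and \<open>t = e \<bullet> y\<close>. It is positively
  1-homogeneous, positive on the closed half space \<open>t \<ge> 0\<close> without the origin, and satisfies
  \<open>r\<^sup>2 \<Delta>h < (n - 2) h\<close> there if \<open>n \<ge> 3\<close>; on the sphere this makes it a strict supersolution of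
  \<open>\<Delta>u + u = 0\<close> on a closed hemisphere. The linear function \<open>t\<close> would also be a
  supersolution, but it vanishes on the equator.\<close>

definition barrier :: "'a::euclidean_space \<Rightarrow> 'a \<Rightarrow> real" where
  "barrier e y = norm y + 2 * real DIM('a) * (e \<bullet> y) - (e \<bullet> y)\<^sup>2 / norm y"

lemma barrier_pos:
  assumes "norm e = 1" "e \<bullet> y \<ge> 0" "y \<noteq> 0"
  shows "barrier e y > 0"
proof (cases "e \<bullet> y = 0")
  case False
  have "e \<bullet> y \<le> norm y" using norm_cauchy_schwarz[of e y] assms by simp
  then have "(e \<bullet> y)\<^sup>2 \<le> (norm y)\<^sup>2" using assms(2) by (rule power_mono)
  then have "(e \<bullet> y)\<^sup>2 / norm y \<le> norm y" using assms(3) by (simp add: divide_le_eq power2_eq_square)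
  moreover have "2 * real DIM('a) * (e \<bullet> y) > 0" using False assms(2) by simp
  ultimately show ?thesis unfolding barrier_def by linarith
qed (use assms in \<open>simp add: barrier_def\<close>)

lemma barrier_scale: "c > 0 \<Longrightarrow> barrier e (c *\<^sub>R y) = c * barrier e y"
  by (simp add: barrier_def power_mult_distrib power2_eq_square algebra_simps)

lemma DERIV_norm_line:
  fixes y v :: "'a::euclidean_space"
  assumes "y + s *\<^sub>R v \<noteq> 0"
  shows "((\<lambda>s. norm (y + s *\<^sub>R v)) has_real_derivative ((y + s *\<^sub>R v) \<bullet> v) / norm (y + s *\<^sub>R v)) (at s)"
proof -
  have "((\<lambda>s. y + s *\<^sub>R v) has_derivative (\<lambda>h. h *\<^sub>R v)) (at s)"
    by (auto intro!: derivative_eq_intros)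
  from has_derivative_compose[OF this has_derivative_norm[OF assms]] show ?thesis
    unfolding has_field_derivative_def
    by (rule has_derivative_eq_rhs) (auto simp: fun_eq_iff sgn_div_norm divide_inverse inner_commute)
qed

text \<open>The derivative along a line of the first derivative of the barrier, at a point where the norm
  \<open>\<rho>\<close> is \<open>1\<close>. Here \<open>q = y \<bullet> v\<close>, \<open>t = e \<bullet> y\<close> and \<open>a = e \<bullet> v\<close> for the line through \<open>y\<close> with unit
  direction \<open>v\<close>.\<close>

lemma DERIV_barrier_at_unit:
  fixes \<rho> :: "real \<Rightarrow> real"
  assumes \<rho>: "(\<rho> has_real_derivative q) (at 0)" and 1: "\<rho> 0 = 1"
  shows "((\<lambda>s. (q + s) / \<rho> s + k - (2 * (t + s * a) * a / \<rho> s - (t + s * a)\<^sup>2 * (q + s) / \<rho> s ^ 3))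
     has_real_derivative (1 - q\<^sup>2 - 2 * a\<^sup>2 + 4 * t * (a * q) + t\<^sup>2 - 3 * t\<^sup>2 * q\<^sup>2)) (at 0)"
proof -
  have n: "\<rho> 0 \<noteq> 0" "\<rho> 0 ^ 3 \<noteq> 0" using 1 by simp_all
  have d1: "((\<lambda>s. (q + s) / \<rho> s) has_real_derivative 1 - q * q) (at 0)"
    by (rule \<rho> derivative_eq_intros n refl)+ (simp add: 1)
  have d2: "((\<lambda>s. 2 * (t + s * a) * a / \<rho> s) has_real_derivative 2 * a * a - 2 * t * a * q) (at 0)"
    by (rule \<rho> derivative_eq_intros n refl)+ (simp add: 1)
  have d3: "((\<lambda>s. (t + s * a)\<^sup>2 * (q + s) / \<rho> s ^ 3) has_real_derivative
      (2 * t * a * q + t\<^sup>2) - t\<^sup>2 * q * (3 * q)) (at 0)"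
    by (rule \<rho> derivative_eq_intros n refl)+ (simp add: 1)
  show ?thesis
    by (rule DERIV_cong[OF DERIV_diff[OF DERIV_add[OF d1 DERIV_const] DERIV_diff[OF d2 d3]]])
      (simp add: power2_eq_square algebra_simps)
qed

text \<open>Summing the second derivatives at \<open>0\<close> over an orthonormal basis of directions \<open>v\<close> gives the
  Laplacian of the barrier.\<close>

lemma barrier_line_derivatives:
  fixes e y v :: "'a::euclidean_space"
  defines "B' \<equiv> \<lambda>s. ((y + s *\<^sub>R v) \<bullet> v) / norm (y + s *\<^sub>R v) + 2 * real DIM('a) * (e \<bullet> v)
    - (2 * (e \<bullet> y + s * (e \<bullet> v)) * (e \<bullet> v) / norm (y + s *\<^sub>R v)
       - (e \<bullet> y + s * (e \<bullet> v))\<^sup>2 * ((y + s *\<^sub>R v) \<bullet> v) / norm (y + s *\<^sub>R v) ^ 3)"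
  shows "y + s *\<^sub>R v \<noteq> 0 \<Longrightarrow> ((\<lambda>s. barrier e (y + s *\<^sub>R v)) has_real_derivative B' s) (at s)"
    and "norm y = 1 \<Longrightarrow> norm v = 1 \<Longrightarrow>
      (B' has_real_derivative (1 - (y \<bullet> v)\<^sup>2 - 2 * (e \<bullet> v)\<^sup>2 + 4 * (e \<bullet> y) * ((e \<bullet> v) * (y \<bullet> v))
        + (e \<bullet> y)\<^sup>2 - 3 * (e \<bullet> y)\<^sup>2 * (y \<bullet> v)\<^sup>2)) (at 0)"
proof -
  have in_e: "e \<bullet> (y + s *\<^sub>R v) = e \<bullet> y + s * (e \<bullet> v)" for s by (simp add: inner_add_right)
  have in_v: "(y + s *\<^sub>R v) \<bullet> v = y \<bullet> v + s * (v \<bullet> v)" for s by (simp add: inner_add_left)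
  show "((\<lambda>s. barrier e (y + s *\<^sub>R v)) has_real_derivative B' s) (at s)" if "y + s *\<^sub>R v \<noteq> 0"
  proof -
    have n: "norm (y + s *\<^sub>R v) \<noteq> 0" using that by simp
    show ?thesis unfolding barrier_def in_e B'_def
      by (rule DERIV_norm_line[OF that] derivative_eq_intros n refl)+
        (use n in \<open>simp add: diff_divide_distrib add_divide_distrib power2_eq_square power3_eq_cube algebra_simps\<close>)
  qed
  show "(B' has_real_derivative (1 - (y \<bullet> v)\<^sup>2 - 2 * (e \<bullet> v)\<^sup>2 + 4 * (e \<bullet> y) * ((e \<bullet> v) * (y \<bullet> v))
        + (e \<bullet> y)\<^sup>2 - 3 * (e \<bullet> y)\<^sup>2 * (y \<bullet> v)\<^sup>2)) (at 0)" if "norm y = 1" "norm v = 1"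
  proof -
    have y0: "y + 0 *\<^sub>R v \<noteq> 0" using that by auto
    have vv: "v \<bullet> v = 1" using that by (simp add: norm_eq_1)
    have "((\<lambda>s. norm (y + s *\<^sub>R v)) has_real_derivative y \<bullet> v) (at 0)"
      using DERIV_norm_line[OF y0] that by simp
    from DERIV_barrier_at_unit[OF this, where t = "e \<bullet> y" and a = "e \<bullet> v"] that show ?thesis
      unfolding B'_def in_v vv by simp
  qed
qed

text \<open>A positively 1-homogeneous \<open>C\<^sup>2\<close> function \<open>f\<close> on \<open>\<real>\<^sup>n - 0\<close> with first and second
  derivatives \<open>f1\<close> and \<open>f2\<close> and \<open>|y|\<^sup>2 \<Delta>f = (n - 2) f\<close>. Since
  \<open>|y|\<^sup>2 \<Delta> = \<Delta>\<^sub>S + n - 1\<close> on such functions, this says that \<open>f\<close> restricts to an eigenfunction of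
  \<open>- \<Delta>\<^sub>S\<close> with eigenvalue \<open>1\<close>.\<close>

locale sphere_eigenfunction =
  fixes f :: "'a::euclidean_space \<Rightarrow> real"
    and f1 :: "'a \<Rightarrow> 'a \<Rightarrow> real" and f2 :: "'a \<Rightarrow> 'a \<Rightarrow> 'a \<Rightarrow> real"
  assumes dim: "DIM('a) \<ge> 3"
    and D1: "\<And>y. y \<noteq> 0 \<Longrightarrow> (f has_derivative f1 y) (at y)"
    and D2: "\<And>y v. y \<noteq> 0 \<Longrightarrow> ((\<lambda>z. f1 z v) has_derivative f2 y v) (at y)"
    and homog: "\<And>y t. y \<noteq> 0 \<Longrightarrow> t > 0 \<Longrightarrow> f (t *\<^sub>R y) = t * f y"
    and pde: "\<And>y. y \<noteq> 0 \<Longrightarrow> (y \<bullet> y) * (\<Sum>b\<in>Basis. f2 y b b) = (real DIM('a) - 2) * f y"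
begin

lemma line1:
  assumes "y + s *\<^sub>R v \<noteq> 0"
  shows "((\<lambda>s. f (y + s *\<^sub>R v)) has_real_derivative f1 (y + s *\<^sub>R v) v) (at s)"
proof -
  have "((\<lambda>s. f (y + s *\<^sub>R v)) has_derivative (\<lambda>h. f1 (y + s *\<^sub>R v) (h *\<^sub>R v))) (at s)"
    by (rule has_derivative_compose[where f = "\<lambda>s. y + s *\<^sub>R v" and g = f, OF _ D1[OF assms]])
      (auto intro!: derivative_eq_intros)
  then show ?thesis
    using has_derivative_linear[OF D1[OF assms]]
    by (simp add: has_field_derivative_def linear_cmul mult_commute_abs)
qed

lemma line2:
  assumes "y \<noteq> 0"
  shows "((\<lambda>s. f1 (y + s *\<^sub>R v) v) has_real_derivative f2 y v v) (at 0)"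
proof -
  have y0: "y + 0 *\<^sub>R v \<noteq> 0" using assms by simp
  have "((\<lambda>s. f1 (y + s *\<^sub>R v) v) has_derivative (\<lambda>h. f2 (y + 0 *\<^sub>R v) v (h *\<^sub>R v))) (at 0)"
    by (rule has_derivative_compose[where f = "\<lambda>s. y + s *\<^sub>R v" and g = "\<lambda>z. f1 z v", OF _ D2[OF y0]])
      (auto intro!: derivative_eq_intros)
  then show ?thesis
    using has_derivative_linear[OF D2[OF assms]]
    by (simp add: has_field_derivative_def linear_cmul mult_commute_abs)
qed

lemma f2_linear_right: "y \<noteq> 0 \<Longrightarrow> linear (f2 y v)"
  using has_derivative_linear[OF D2] .

text \<open>The second derivative is also linear in the direction of the first differentiation, because
  \<open>f1 z\<close> is linear at every \<open>z \<noteq> 0\<close>.\<close>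

lemma f2_linear_left:
  assumes "y \<noteq> 0" shows "linear (\<lambda>v. f2 y v w)"
proof -
  have lin: "linear (f1 z)" if "z \<noteq> 0" for z using has_derivative_linear[OF D1[OF that]] .
  have U: "open (- {0::'a})" "y \<in> - {0}" using assms by auto
  have "f2 y (a + b) = (\<lambda>w. f2 y a w + f2 y b w)" for a b
  proof -
    have "((\<lambda>z. f1 z (a + b)) has_derivative (\<lambda>w. f2 y a w + f2 y b w)) (at y)"
      by (rule has_derivative_transform_within_open[OF has_derivative_add[OF D2[OF assms] D2[OF assms]] U])
        (use lin linear_add in fastforce)
    then show ?thesis using D2[OF assms] has_derivative_unique by blast
  qed
  moreover have "f2 y (c *\<^sub>R a) = (\<lambda>w. c * f2 y a w)" for a c
  proof -
    have "((\<lambda>z. f1 z (c *\<^sub>R a)) has_derivative (\<lambda>w. c * f2 y a w)) (at y)"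
      by (rule has_derivative_transform_within_open[OF has_derivative_mult_right[OF D2[OF assms]] U])
        (use lin linear_cmul in fastforce)
    then show ?thesis using D2[OF assms] has_derivative_unique by blast
  qed
  ultimately show ?thesis by (intro linearI) (simp_all add: fun_eq_iff)
qed

text \<open>The trace of a bilinear form does not depend on the orthonormal basis; here the second basis is
  the mirror image of the first.\<close>

lemma laplacian_reflection:
  assumes "norm e = 1" "y \<noteq> 0"
  shows "(\<Sum>b\<in>Basis. f2 y (b - (2 * (e \<bullet> b)) *\<^sub>R e) (b - (2 * (e \<bullet> b)) *\<^sub>R e)) = (\<Sum>b\<in>Basis. f2 y b b)"
proof -
  interpret L: linear "\<lambda>v. f2 y v w" for w using f2_linear_left[OF assms(2)] .
  interpret R: linear "f2 y v" for v using f2_linear_right[OF assms(2)] .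
  have e: "(\<Sum>b\<in>Basis. (e \<bullet> b) *\<^sub>R b) = e" by (rule euclidean_representation)
  have 1: "(\<Sum>b\<in>Basis. (e \<bullet> b) * f2 y b e) = f2 y e e"
    using arg_cong[OF e, of "\<lambda>v. f2 y v e"] by (simp add: L.sum L.scaleR)
  have 2: "(\<Sum>b\<in>Basis. (e \<bullet> b) * f2 y e b) = f2 y e e"
    using arg_cong[OF e, of "f2 y e"] by (simp add: R.sum R.scaleR)
  have 3: "(\<Sum>b\<in>Basis. (e \<bullet> b) * (e \<bullet> b)) = 1"
    using euclidean_inner[of e e] assms(1) by (simp add: norm_eq_1)
  have "(\<Sum>b\<in>Basis. f2 y (b - (2 * (e \<bullet> b)) *\<^sub>R e) (b - (2 * (e \<bullet> b)) *\<^sub>R e)) =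
    (\<Sum>b\<in>Basis. f2 y b b - 2 * ((e \<bullet> b) * f2 y b e) - 2 * ((e \<bullet> b) * f2 y e b)
       + (4 * f2 y e e) * ((e \<bullet> b) * (e \<bullet> b)))"
    by (intro sum.cong refl) (simp add: L.diff R.diff L.scaleR R.scaleR algebra_simps)
  also have "\<dots> = (\<Sum>b\<in>Basis. f2 y b b) - 2 * f2 y e e - 2 * f2 y e e + 4 * f2 y e e * 1"
    by (simp only: sum.distrib sum_subtractf sum_distrib_left[symmetric] 1 2 3)
  finally show ?thesis by simp
qed

text \<open>The difference \<open>g\<close> of \<open>f\<close> and its reflection satisfies the same equation and vanishes on the
  equator. If \<open>g\<close> were positive somewhere on the hemisphere, then the quotient of \<open>g\<close> by the barrier
  would have a positive maximum \<open>M\<close> at an interior point, where \<open>\<Delta>(g - M h) \<le> 0\<close> contradicts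
  the strict inequality for the barrier \<open>h\<close>.\<close>

lemma le_reflection:
  assumes e: "norm e = 1" and "norm x = 1" "e \<bullet> x \<ge> 0"
  shows "f x \<le> f (x - (2 * (e \<bullet> x)) *\<^sub>R e)"
proof -
  define R where "R = (\<lambda>v. v - (2 * (e \<bullet> v)) *\<^sub>R e)"
  have ee: "e \<bullet> e = 1" using e by (simp add: norm_eq_1)
  have R_line: "R (y + s *\<^sub>R v) = R y + s *\<^sub>R R v" for y s v
    by (simp add: R_def algebra_simps inner_add_right)
  have R_scale: "R (s *\<^sub>R v) = s *\<^sub>R R v" for s v by (simp add: R_def algebra_simps)
  have "R v \<bullet> R v = v \<bullet> v" for v
    by (simp add: R_def inner_diff_left inner_diff_right ee inner_commute)
  then have R_norm: "norm (R v) = norm v" for v by (simp add: norm_eq_sqrt_inner)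
  then have R0: "R v \<noteq> 0" if "v \<noteq> 0" for v using that by (metis norm_eq_zero)
  define g where "g = (\<lambda>y. f y - f (R y))"
  define K where "K = {y. norm y = 1 \<and> e \<bullet> y \<ge> 0}"
  have "compact K"
  proof -
    have "K = sphere 0 1 \<inter> {y. e \<bullet> y \<ge> 0}" by (auto simp: K_def)
    then show ?thesis by (simp add: compact_Int_closed closed_halfspace_ge)
  qed
  have cf: "continuous_on (- {0}) f"
    by (intro continuous_at_imp_continuous_on ballI has_derivative_continuous[OF D1]) auto
  have "continuous_on K (\<lambda>y. g y / barrier e y)"
  proof -
    have "R z \<noteq> 0" if "z \<in> K" for z
    proof -
      have "z \<noteq> 0" using that by (auto simp: K_def)
      then show ?thesis by (rule R0)
    qed
    then have RK: "R ` K \<subseteq> - {0}" by auto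
    have "continuous_on K R" unfolding R_def by (intro continuous_intros)
    then have "continuous_on K (\<lambda>y. f (R y))"
      by (rule continuous_on_compose2[OF cf _ RK])
    moreover have "continuous_on K f" by (rule continuous_on_subset[OF cf]) (auto simp: K_def)
    moreover have "continuous_on K (barrier e)"
      unfolding barrier_def by (intro continuous_intros) (auto simp: K_def)
    moreover have "barrier e y \<noteq> 0" if "y \<in> K" for y
    proof -
      have "y \<noteq> 0" using that by (auto simp: K_def)
      then show ?thesis using barrier_pos[OF e, of y] that by (simp add: K_def)
    qed
    ultimately show ?thesis unfolding g_def by (intro continuous_on_divide continuous_on_diff) auto
  qed
  moreover have "x \<in> K" using assms by (simp add: K_def)
  ultimately obtain y where y: "y \<in> K" and max: "\<And>z. z \<in> K \<Longrightarrow> g z / barrier e z \<le> g y / barrier e y"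
    using continuous_attains_sup[OF \<open>compact K\<close>] by blast
  define M where "M = g y / barrier e y"
  have gM: "g z \<le> M * barrier e z" if "z \<noteq> 0" "e \<bullet> z \<ge> 0" for z
  proof -
    let ?z = "(1 / norm z) *\<^sub>R z"
    have "?z \<in> K" using that by (simp add: K_def)
    moreover have "?z \<noteq> 0" using that by simp
    ultimately have "g ?z \<le> M * barrier e ?z"
      using max[of ?z] barrier_pos[OF e, of ?z] by (simp add: K_def M_def divide_le_eq)
    moreover have "g ?z = (1 / norm z) * g z"
      unfolding g_def R_scale using that R0[OF that(1)] by (simp add: homog field_simps)
    moreover have "barrier e ?z = (1 / norm z) * barrier e z"
      by (rule barrier_scale) (use that in simp)
    ultimately show ?thesis using that by (simp add: field_simps)
  qed
  have M0: "M \<le> 0"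
  proof (rule ccontr)
    assume "\<not> M \<le> 0"
    then have M: "M > 0" by simp
    have y1: "norm y = 1" "e \<bullet> y \<ge> 0" "y \<noteq> 0" using y by (auto simp: K_def)
    have bp: "barrier e y > 0" by (rule barrier_pos[OF e]) (use y1 in auto)
    then have gy: "g y = M * barrier e y" by (simp add: M_def)
    then have "g y \<noteq> 0" using M bp by simp
    then have "e \<bullet> y \<noteq> 0" by (auto simp: g_def R_def)
    then have t: "e \<bullet> y > 0" using y1 by simp
    let ?B2 = "\<lambda>v. 1 - (y \<bullet> v)\<^sup>2 - 2 * (e \<bullet> v)\<^sup>2 + 4 * (e \<bullet> y) * ((e \<bullet> v) * (y \<bullet> v))
        + (e \<bullet> y)\<^sup>2 - 3 * (e \<bullet> y)\<^sup>2 * (y \<bullet> v)\<^sup>2"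
    have le: "f2 y v v - f2 (R y) (R v) (R v) - M * ?B2 v \<le> 0" if "v \<in> Basis" for v
    proof -
      have v: "norm v = 1" using that by simp
      have "\<bar>e \<bullet> v\<bar> \<le> 1" using Cauchy_Schwarz_ineq2[of e v] e v by simp
      have in_half: "e \<bullet> (y + s *\<^sub>R v) > 0" if "\<bar>s\<bar> < e \<bullet> y" for s
      proof -
        have "\<bar>s * (e \<bullet> v)\<bar> \<le> \<bar>s\<bar> * 1" unfolding abs_mult
          by (rule mult_left_mono[OF \<open>\<bar>e \<bullet> v\<bar> \<le> 1\<close>]) simp
        then show ?thesis using that by (simp add: inner_add_right)
      qed
      have nz: "y + s *\<^sub>R v \<noteq> 0" if "\<bar>s\<bar> < e \<bullet> y" for s using in_half[OF that] by auto
      let ?u = "\<lambda>s. f (y + s *\<^sub>R v) - f (R y + s *\<^sub>R R v) - M * barrier e (y + s *\<^sub>R v)"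
      show ?thesis
      proof (rule second_derivative_nonpos_at_max[of "e \<bullet> y" ?u])
        show "(?u has_real_derivative f1 (y + s *\<^sub>R v) v - f1 (R y + s *\<^sub>R R v) (R v)
           - M * (((y + s *\<^sub>R v) \<bullet> v) / norm (y + s *\<^sub>R v) + 2 * real DIM('a) * (e \<bullet> v)
    - (2 * (e \<bullet> y + s * (e \<bullet> v)) * (e \<bullet> v) / norm (y + s *\<^sub>R v)
       - (e \<bullet> y + s * (e \<bullet> v))\<^sup>2 * ((y + s *\<^sub>R v) \<bullet> v) / norm (y + s *\<^sub>R v) ^ 3))) (at s)"
          if "\<bar>s\<bar> < e \<bullet> y" for s
          by (intro DERIV_diff DERIV_cmult line1 barrier_line_derivatives(1) nz[OF that])
            (use R0[OF nz[OF that]] R_line in simp)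
        show "((\<lambda>s. f1 (y + s *\<^sub>R v) v - f1 (R y + s *\<^sub>R R v) (R v)
           - M * (((y + s *\<^sub>R v) \<bullet> v) / norm (y + s *\<^sub>R v) + 2 * real DIM('a) * (e \<bullet> v)
    - (2 * (e \<bullet> y + s * (e \<bullet> v)) * (e \<bullet> v) / norm (y + s *\<^sub>R v)
       - (e \<bullet> y + s * (e \<bullet> v))\<^sup>2 * ((y + s *\<^sub>R v) \<bullet> v) / norm (y + s *\<^sub>R v) ^ 3)))
          has_real_derivative f2 y v v - f2 (R y) (R v) (R v) - M * ?B2 v) (at 0)"
          by (intro DERIV_diff DERIV_cmult line2 barrier_line_derivatives(2) y1 v R0)
        show "?u s \<le> ?u 0" if "\<bar>s\<bar> < e \<bullet> y" for s
        proof -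
          have "?u s \<le> 0"
            using gM[OF nz[OF that]] in_half[OF that] by (simp add: g_def R_line)
          moreover have "?u 0 = 0" using gy by (simp add: g_def)
          ultimately show ?thesis by simp
        qed
      qed (use t in simp)
    qed
    define B2 where "B2 = ?B2"
    have "(\<Sum>v\<in>Basis. f2 y v v - f2 (R y) (R v) (R v) - M * B2 v) \<le> 0"
      by (rule sum_nonpos) (use le in \<open>auto simp: B2_def\<close>)
    then have "(\<Sum>v\<in>Basis. f2 y v v) - (\<Sum>v\<in>Basis. f2 (R y) (R v) (R v)) - M * (\<Sum>v\<in>Basis. B2 v) \<le> 0"
      by (simp only: sum_subtractf sum_distrib_left)
    moreover have "(\<Sum>v\<in>Basis. f2 y v v) = (real DIM('a) - 2) * f y"
      using pde[OF y1(3)] y1(1) by (simp add: norm_eq_1)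
    moreover have "(\<Sum>v\<in>Basis. f2 (R y) (R v) (R v)) = (real DIM('a) - 2) * f (R y)"
    proof -
      have "(\<Sum>v\<in>Basis. f2 (R y) (R v) (R v)) = (\<Sum>v\<in>Basis. f2 (R y) v v)"
        using laplacian_reflection[OF e R0[OF y1(3)]] unfolding R_def .
      then show ?thesis using pde[OF R0[OF y1(3)]] R_norm[of y] y1(1) by (simp add: norm_eq_1)
    qed
    \<comment> \<open>\<open>\<Delta>h = n - 3 + (n + 1) t\<^sup>2\<close> on the unit sphere\<close>
    moreover have "(\<Sum>v\<in>Basis. B2 v) = real DIM('a) - 3 + (real DIM('a) + 1) * (e \<bullet> y)\<^sup>2"
    proof -
      have s1: "(\<Sum>v\<in>Basis. (y \<bullet> v)\<^sup>2) = 1" using euclidean_inner[of y y] y1(1)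
        by (simp add: norm_eq_1 power2_eq_square)
      have s2: "(\<Sum>v\<in>Basis. (e \<bullet> v)\<^sup>2) = 1" using euclidean_inner[of e e] ee
        by (simp add: power2_eq_square)
      have s3: "(\<Sum>v\<in>Basis. (e \<bullet> v) * (y \<bullet> v)) = e \<bullet> y" by (rule euclidean_inner[symmetric])
      have "(\<Sum>v\<in>Basis. ?B2 v) = real DIM('a) - 1 - 2 * 1 + 4 * (e \<bullet> y) * (e \<bullet> y)
          + real DIM('a) * (e \<bullet> y)\<^sup>2 - 3 * (e \<bullet> y)\<^sup>2 * 1"
        by (simp only: sum.distrib sum_subtractf s1 s2 s3 sum_distrib_left[symmetric] sum_constant)
      then show ?thesis unfolding B2_def by (simp add: power2_eq_square algebra_simps)
    qed
    ultimately have "(real DIM('a) - 2) * g y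
        \<le> M * (real DIM('a) - 3 + (real DIM('a) + 1) * (e \<bullet> y)\<^sup>2)"
      by (simp add: g_def algebra_simps)
    then have "M * ((real DIM('a) - 2) * barrier e y)
        \<le> M * (real DIM('a) - 3 + (real DIM('a) + 1) * (e \<bullet> y)\<^sup>2)"
      unfolding gy by (simp add: algebra_simps)
    then have le2: "(real DIM('a) - 2) * barrier e y \<le> real DIM('a) - 3 + (real DIM('a) + 1) * (e \<bullet> y)\<^sup>2"
      using M by simp
    \<comment> \<open>the coefficient \<open>2n\<close> of the barrier is large enough for \<open>(2n - 1) t\<^sup>2 \<le> 2n (n - 2) t\<close> on \<open>[0, 1]\<close>\<close>
    let ?n = "real DIM('a)" and ?t = "e \<bullet> y"
    have n: "?n \<ge> 3" using dim by simp
    have t1: "?t \<le> 1" using norm_cauchy_schwarz[of e y] e y1 by simp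
    have "?t\<^sup>2 \<le> ?t" using t t1 by (simp add: power2_eq_square mult_left_le)
    then have "(2 * ?n - 1) * ?t\<^sup>2 \<le> (2 * ?n - 1) * ?t" by (rule mult_left_mono) (use n in simp)
    also have "\<dots> \<le> (2 * ?n * (?n - 2)) * ?t"
    proof (rule mult_right_mono)
      have "2 * ?n * 1 \<le> 2 * ?n * (?n - 2)" by (rule mult_left_mono) (use n in auto)
      then show "2 * ?n - 1 \<le> 2 * ?n * (?n - 2)" by linarith
    qed (use t in simp)
    finally show False using le2 y1(1) by (simp add: barrier_def algebra_simps power2_eq_square)
  qed
  have x0: "x \<noteq> 0" using assms by auto
  have "g x \<le> M * barrier e x" using gM[OF x0 assms(3)] .
  also have "\<dots> \<le> 0"
    using M0 barrier_pos[OF e assms(3) x0] by (intro mult_nonpos_nonneg) auto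
  finally show ?thesis by (simp add: g_def R_def)
qed

text \<open>Distinct points \<open>u\<close>, \<open>v\<close> of the sphere are exchanged by the reflection in the hyperplane
  orthogonal to \<open>u - v\<close>, and \<open>u\<close> lies on the positive side of this hyperplane.\<close>

lemma constant_on_sphere:
  assumes "norm u = 1" "norm v = 1"
  shows "f u = f v"
proof -
  have le: "f u \<le> f v" if "norm u = 1" "norm v = 1" "u \<noteq> v" for u v
  proof -
    define e where "e = (1 / norm (u - v)) *\<^sub>R (u - v)"
    have d: "norm (u - v) \<noteq> 0" using that by simp
    have uv: "u \<bullet> u = 1" "v \<bullet> v = 1" using that by (simp_all add: norm_eq_1)
    have n2: "(norm (u - v))\<^sup>2 = 2 * ((u - v) \<bullet> u)"
      by (simp add: power2_norm_eq_inner inner_diff_left inner_diff_right uv inner_commute)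
    have eu: "e \<bullet> u = norm (u - v) / 2"
      unfolding e_def inner_scaleR_left using n2 d by (simp add: field_simps power2_eq_square)
    have "u - (2 * (e \<bullet> u)) *\<^sub>R e = v" unfolding eu using d by (simp add: e_def)
    moreover have "norm e = 1" using d by (simp add: e_def)
    moreover have "e \<bullet> u \<ge> 0" unfolding eu by simp
    ultimately show ?thesis using le_reflection[of e u] that by metis
  qed
  show ?thesis using le[OF assms] le[OF assms(2,1)] by (cases "u = v") auto
qed

text \<open>On a function \<open>c r\<close> the equation reads \<open>(n - 1) c = (n - 2) c\<close>.\<close>

theorem eq_0:
  assumes "x \<noteq> 0" shows "f x = 0"
proof -
  define y where "y = (1 / norm x) *\<^sub>R x"
  have y1: "norm y = 1" "y \<noteq> 0" using assms by (simp_all add: y_def)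
  define c where "c = f y"
  have fc: "f z = c * norm z" if "z \<noteq> 0" for z
  proof -
    have "f z = norm z * f ((1 / norm z) *\<^sub>R z)" using homog[OF that, of "1 / norm z"] that by simp
    also have "f ((1 / norm z) *\<^sub>R z) = c" unfolding c_def
      by (rule constant_on_sphere) (use that y1 in auto)
    finally show ?thesis by simp
  qed
  have "f2 y v v = c * (1 - (y \<bullet> v)\<^sup>2)" if "v \<in> Basis" for v
  proof -
    have v: "norm v = 1" using that by simp
    have vv: "v \<bullet> v = 1" using v by (simp add: norm_eq_1)
    have nz: "y + s *\<^sub>R v \<noteq> 0" if "\<bar>s\<bar> < 1" for s
    proof
      assume "y + s *\<^sub>R v = 0"
      then have "norm y = norm (s *\<^sub>R v)" by (metis add_eq_0_iff norm_minus_cancel)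
      then show False using that y1 v by simp
    qed
    have d1: "f1 (y + s *\<^sub>R v) v = c * (((y + s *\<^sub>R v) \<bullet> v) / norm (y + s *\<^sub>R v))" if "s \<in> ball 0 1" for s
    proof -
      have s: "\<bar>s\<bar> < 1" using that by simp
      have "((\<lambda>s. f (y + s *\<^sub>R v)) has_real_derivative
          c * (((y + s *\<^sub>R v) \<bullet> v) / norm (y + s *\<^sub>R v))) (at s)"
        by (rule has_field_derivative_transform_within_open[OF DERIV_cmult[OF DERIV_norm_line[OF nz[OF s]]]
              open_ball that]) (use nz fc in simp)
      then show ?thesis using line1[OF nz[OF s]] DERIV_unique by blast
    qed
    have y0: "y + 0 *\<^sub>R v \<noteq> 0" using y1 by simp
    have n0: "norm (y + 0 *\<^sub>R v) \<noteq> 0" using y1 by simp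
    have in_v: "(y + s *\<^sub>R v) \<bullet> v = y \<bullet> v + s * (v \<bullet> v)" for s by (simp add: inner_add_left)
    have "((\<lambda>s. c * (((y + s *\<^sub>R v) \<bullet> v) / norm (y + s *\<^sub>R v))) has_real_derivative c * (1 - (y \<bullet> v)\<^sup>2)) (at 0)"
      unfolding in_v
      by (rule DERIV_norm_line[OF y0] derivative_eq_intros n0 refl)+
        (simp add: y1 vv power2_eq_square algebra_simps)
    then have "((\<lambda>s. f1 (y + s *\<^sub>R v) v) has_real_derivative c * (1 - (y \<bullet> v)\<^sup>2)) (at 0)"
      by (rule has_field_derivative_transform_within_open[where S = "ball 0 1"]) (use d1 in auto)
    then show ?thesis using line2[OF y1(2)] DERIV_unique by blast
  qed
  then have "(\<Sum>v\<in>Basis. f2 y v v) = c * (real DIM('a) - (\<Sum>v\<in>Basis. (y \<bullet> v)\<^sup>2))"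
    by (simp add: sum_subtractf flip: sum_distrib_left)
  also have "(\<Sum>v\<in>Basis. (y \<bullet> v)\<^sup>2) = 1"
    using euclidean_inner[of y y] y1(1) by (simp add: norm_eq_1 power2_eq_square)
  finally have "c * (real DIM('a) - 1) = (real DIM('a) - 2) * c"
    using pde[OF y1(2)] y1(1) by (simp add: norm_eq_1 c_def)
  then have "c = 0" by (simp add: algebra_simps)
  then show ?thesis using fc[OF assms] by simp
qed

end

section \<open>Partial derivatives\<close>

lemma pd_cong:
  assumes "open S" "y \<in> S" "\<And>z. z \<in> S \<Longrightarrow> F z = G z"
  shows "pd i F y = pd i G y"
proof -
  have "(F has_derivative D) (at y) \<longleftrightarrow> (G has_derivative D) (at y)" for D
    using has_derivative_transform_within_open[OF _ assms(1,2)] assms(3) by metis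
  then show ?thesis by (simp add: pd_def frechet_derivative_def)
qed

lemma open_slit: "open (- {0::real^'n})" by (simp add: open_Compl)

lemma pd_eqI: "(F has_derivative D) (at y) \<Longrightarrow> D (axis i 1) = d \<Longrightarrow> pd i F y = d"
  unfolding pd_def using frechet_derivative_at by metis

lemma pd_const [simp]: "pd i (\<lambda>z. c) y = 0"
  by (rule pd_eqI[OF has_derivative_const]) simp

lemma pd_add: "F differentiable at y \<Longrightarrow> G differentiable at y \<Longrightarrow>
    pd i (\<lambda>z. F z + G z) y = pd i F y + pd i G y"
  by (rule pd_eqI[OF has_derivative_add]) (auto simp: frechet_derivative_works pd_def)

lemma pd_diff: "F differentiable at y \<Longrightarrow> G differentiable at y \<Longrightarrow>
    pd i (\<lambda>z. F z - G z) y = pd i F y - pd i G y"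
  by (rule pd_eqI[OF has_derivative_diff]) (auto simp: frechet_derivative_works pd_def)

lemma pd_mult: "F differentiable at y \<Longrightarrow> G differentiable at y \<Longrightarrow>
    pd i (\<lambda>z. F z * G z) y = F y * pd i G y + pd i F y * G y"
  by (rule pd_eqI[OF has_derivative_mult]) (auto simp: frechet_derivative_works pd_def)

lemma pd_cmult: "F differentiable at y \<Longrightarrow> pd i (\<lambda>z. c * F z) y = c * pd i F y"
  by (simp add: pd_mult)

lemma pd_sum: "(\<And>a. a \<in> A \<Longrightarrow> F a differentiable at y) \<Longrightarrow>
    pd i (\<lambda>z. \<Sum>a\<in>A. F a z) y = (\<Sum>a\<in>A. pd i (F a) y)"
  by (rule pd_eqI[OF has_derivative_sum]) (auto simp: frechet_derivative_works pd_def)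

lemma differentiable_nth [simp]: "(\<lambda>z::real^'n. z $ j) differentiable at y"
  by (simp add: bounded_linear_imp_differentiable bounded_linear_vec_nth)

lemma pd_nth: "pd i (\<lambda>z::real^'n. z $ j) y = (if i = j then 1 else 0)"
  by (rule pd_eqI[OF bounded_linear_imp_has_derivative[OF bounded_linear_vec_nth]])
    (simp add: axis_def)

lemma smooth_on_differentiable: "smooth_on S F \<Longrightarrow> y \<in> S \<Longrightarrow> F differentiable at y"
  using smooth_on_has_derivative differentiable_def by blast

lemma linear_eq_sum_axis:
  assumes "linear (D :: real^'n \<Rightarrow> 'b::real_vector)"
  shows "D v = (\<Sum>i\<in>UNIV. (v $ i) *\<^sub>R D (axis i 1))"
proof -
  have "v = (\<Sum>i\<in>UNIV. (v $ i) *\<^sub>R axis i 1)"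
    using basis_expansion[of v] by (simp add: scalar_mult_eq_scaleR)
  then have "D v = D (\<Sum>i\<in>UNIV. (v $ i) *\<^sub>R axis i 1)" by simp
  also have "\<dots> = (\<Sum>i\<in>UNIV. (v $ i) *\<^sub>R D (axis i 1))"
    by (simp add: linear_sum[OF assms] linear_cmul[OF assms])
  finally show ?thesis .
qed

lemma has_derivative_pd:
  fixes F :: "real^'n \<Rightarrow> real"
  assumes "F differentiable at y"
  shows "(F has_derivative (\<lambda>v. \<Sum>i\<in>UNIV. v $ i * pd i F y)) (at y)"
proof -
  have D: "(F has_derivative frechet_derivative F (at y)) (at y)"
    using assms frechet_derivative_works by blast
  then have "frechet_derivative F (at y) v = (\<Sum>i\<in>UNIV. v $ i * pd i F y)" for v
    using linear_eq_sum_axis[OF has_derivative_linear[OF D], of v] by (simp add: pd_def)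
  then show ?thesis using D by presburger
qed

lemma euler_homogeneous:
  fixes F :: "real^'n \<Rightarrow> real"
  assumes "F differentiable at y" "\<And>t. t > 0 \<Longrightarrow> F (t *\<^sub>R y) = t * F y"
  shows "(\<Sum>i\<in>UNIV. y $ i * pd i F y) = F y"
proof -
  have F: "(F has_derivative (\<lambda>v. \<Sum>i\<in>UNIV. v $ i * pd i F y)) (at (1 *\<^sub>R y))"
    using has_derivative_pd[OF assms(1)] by simp
  have "((\<lambda>t. F (t *\<^sub>R y)) has_derivative (\<lambda>s. \<Sum>i\<in>UNIV. (s *\<^sub>R y) $ i * pd i F y)) (at 1)"
    by (rule has_derivative_compose[where f = "\<lambda>t. t *\<^sub>R y" and g = F, OF _ F])
      (auto intro!: derivative_eq_intros)
  moreover have "((\<lambda>t. F (t *\<^sub>R y)) has_derivative (\<lambda>s. s * F y)) (at 1)"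
  proof (rule has_derivative_transform_within_open)
    show "((\<lambda>t. t * F y) has_derivative (\<lambda>s. s * F y)) (at 1)"
      by (auto intro!: derivative_eq_intros)
    show "open {0::real<..}" by simp
  qed (use assms(2) in auto)
  ultimately have "(\<lambda>s. \<Sum>i\<in>UNIV. (s *\<^sub>R y) $ i * pd i F y) = (\<lambda>s. s * F y)"
    by (rule has_derivative_unique)
  from fun_cong[OF this, of 1] show ?thesis by simp
qed


section \<open>Orthonormal frames of a scalar product\<close>

definition bil :: "('n::finite \<Rightarrow> 'n \<Rightarrow> real) \<Rightarrow> real^'n \<Rightarrow> real^'n \<Rightarrow> real" where
  "bil g u v = (\<Sum>a\<in>UNIV. \<Sum>b\<in>UNIV. g a b * u $ a * v $ b)"

definition scalar_product :: "('n::finite \<Rightarrow> 'n \<Rightarrow> real) \<Rightarrow> bool" where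
  "scalar_product g \<longleftrightarrow> (\<forall>a b. g a b = g b a) \<and> (\<forall>v. v \<noteq> 0 \<longrightarrow> bil g v v > 0)"

lemma linear_bil_left: "linear (\<lambda>u. bil g u v)"
  by (rule linearI) (simp_all add: bil_def algebra_simps sum.distrib sum_distrib_left)

lemma linear_bil_right: "linear (bil g u)"
  by (rule linearI) (simp_all add: bil_def algebra_simps sum.distrib sum_distrib_left)

lemma bil_commute: "scalar_product g \<Longrightarrow> bil g u v = bil g v u"
  unfolding bil_def scalar_product_def by (subst sum.swap) (simp add: mult.commute mult.left_commute)

lemma orthonormal_frame_exists:
  fixes g :: "'n::finite \<Rightarrow> 'n \<Rightarrow> real"
  assumes g: "scalar_product g"
  obtains E :: "'n \<Rightarrow> real^'n" where "\<And>c d. bil g (E c) (E d) = (if c = d then 1 else 0)"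
proof -
  \<comment> \<open>Gram-Schmidt, one vector at a time\<close>
  have "\<exists>B::(real^'n) set. finite B \<and> card B = k \<and> (\<forall>b\<in>B. \<forall>c\<in>B. bil g b c = (if b = c then 1 else 0))"
    if "k \<le> CARD('n)" for k
    using that
  proof (induction k)
    case 0
    show ?case by (rule exI[of _ "{}"]) simp
  next
    case (Suc k)
    then obtain B :: "(real^'n) set" where B: "finite B" "card B = k"
      and on: "\<And>b c. b \<in> B \<Longrightarrow> c \<in> B \<Longrightarrow> bil g b c = (if b = c then 1 else 0)" by auto
    have "dim B \<le> k" using dim_le_card[of B B] B span_superset by blast
    then have "dim B < DIM(real^'n)" using Suc.prems by simp
    then have "span B \<noteq> UNIV" by (metis dim_UNIV dim_span less_irrefl)
    then obtain v where v: "v \<notin> span B" by blast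
    define w where "w = v - (\<Sum>b\<in>B. bil g v b *\<^sub>R b)"
    have "(\<Sum>b\<in>B. bil g v b *\<^sub>R b) \<in> span B"
      by (intro span_sum span_scale span_base)
    then have w0: "w \<noteq> 0" using v by (auto simp: w_def)
    have wB: "bil g w c = 0" if "c \<in> B" for c
    proof -
      have "bil g w c = bil g v c - (\<Sum>b\<in>B. bil g v b * bil g b c)"
        unfolding w_def
        by (simp add: linear_diff[OF linear_bil_left] linear_sum[OF linear_bil_left]
            linear_cmul[OF linear_bil_left])
      also have "(\<Sum>b\<in>B. bil g v b * bil g b c) = (\<Sum>b\<in>B. if b = c then bil g v c else 0)"
        by (rule sum.cong) (use on that in auto)
      finally show ?thesis using B that by simp
    qed
    define e where "e = (1 / sqrt (bil g w w)) *\<^sub>R w"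
    have ww: "bil g w w > 0" using g w0 by (simp add: scalar_product_def)
    have ec: "bil g e c = bil g w c / sqrt (bil g w w)" for c
      by (simp add: e_def linear_cmul[OF linear_bil_left])
    have ee: "bil g e e = 1"
      unfolding ec using ww
      by (simp add: e_def linear_cmul[OF linear_bil_right] real_divide_square_eq flip: real_sqrt_mult)
    have eB: "bil g e c = 0" "bil g c e = 0" if "c \<in> B" for c
      using wB[OF that] bil_commute[OF g, of e c] by (simp_all add: ec)
    have "e \<notin> B" using eB ee by fastforce
    then show ?case using B on ee eB
      by (intro exI[of _ "insert e B"]) auto
  qed
  from this[of "CARD('n)"] obtain B :: "(real^'n) set" where B: "finite B" "card B = CARD('n)"
    and on: "\<And>b c. b \<in> B \<Longrightarrow> c \<in> B \<Longrightarrow> bil g b c = (if b = c then 1 else 0)" by auto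
  obtain E :: "'n \<Rightarrow> real^'n" where E: "bij_betw E UNIV B"
    using finite_same_card_bij[of "UNIV :: 'n set" B] B by auto
  show ?thesis
  proof
    show "bil g (E c) (E d) = (if c = d then 1 else 0)" for c d
      using on[of "E c" "E d"] E by (auto simp: bij_betw_def inj_eq)
  qed
qed

text \<open>The matrix \<open>E\<close> of an orthonormal frame satisfies \<open>E\<^sup>T g E = 1\<close>, hence \<open>g E E\<^sup>T = 1\<close>.\<close>

lemma orthonormal_frame_inverse:
  fixes g :: "'n::finite \<Rightarrow> 'n \<Rightarrow> real" and E :: "'n \<Rightarrow> real^'n"
  assumes "\<And>c d. bil g (E c) (E d) = (if c = d then 1 else 0)"
  shows "(\<Sum>b\<in>UNIV. g a b * (\<Sum>c\<in>UNIV. E c $ b * E c $ d)) = (if a = d then 1 else 0)"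
proof -
  let ?G = "\<chi> a b. g a b" and ?M = "\<chi> c a. E c $ a"
  have "(?M ** (?G ** transpose ?M)) $ c $ d = (mat 1 :: real^'n^'n) $ c $ d" for c d
    using assms[of c d]
    by (simp add: matrix_matrix_mult_def transpose_def mat_def bil_def sum_distrib_left mult_ac)
  then have "?M ** (?G ** transpose ?M) = mat 1" by (simp add: vec_eq_iff)
  then have "?G ** transpose ?M ** ?M = mat 1" using matrix_left_right_inverse by blast
  then have "(?G ** (transpose ?M ** ?M)) $ a $ d = (mat 1 :: real^'n^'n) $ a $ d"
    by (simp add: matrix_mul_assoc)
  then show ?thesis
    by (simp add: matrix_matrix_mult_def transpose_def mat_def)
qed

lemma scalar_product_invertible:
  assumes "scalar_product g"
  shows "invertible (\<chi> a b. g a b)"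
proof -
  have "v = 0" if "(\<chi> a b. g a b) *v v = 0" for v
  proof (rule ccontr)
    assume "v \<noteq> 0"
    have "(\<Sum>b\<in>UNIV. g a b * v $ b) = 0" for a
      using arg_cong[OF that, of "\<lambda>w. w $ a"] by (simp add: matrix_vector_mult_def)
    then have "bil g v v = 0"
      unfolding bil_def by (simp add: mult.assoc mult.left_commute flip: sum_distrib_left)
    moreover have "bil g v v > 0" using assms \<open>v \<noteq> 0\<close> by (simp add: scalar_product_def)
    ultimately show False by simp
  qed
  then show ?thesis
    using matrix_left_invertible_ker[of "\<chi> a b. g a b"] invertible_left_inverse by blast
qed


definition lower :: "('n::finite \<Rightarrow> 'n \<Rightarrow> real) \<Rightarrow> 'n \<Rightarrow> real^'n \<Rightarrow> real" where
  "lower g a y = (\<Sum>c\<in>UNIV. g a c * y $ c)"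

lemma lower_diff [simp]: "lower g a differentiable at y"
  unfolding lower_def[abs_def] by (intro differentiable_sum) auto

lemma pd_lower: "pd c (lower g a) y = g a c"
  unfolding lower_def[abs_def]
  by (subst pd_sum) (auto simp: pd_cmult pd_nth mult_delta_right)

lemma bil_lower: "bil g y y = (\<Sum>a\<in>UNIV. lower g a y * y $ a)"
  by (simp add: bil_def lower_def sum_distrib_right sum_distrib_left mult_ac)

lemma bil_diff [simp]: "(\<lambda>y. bil g y y) differentiable at y"
  unfolding bil_lower by (intro differentiable_sum differentiable_mult) auto

lemma pd_bil: "pd c (\<lambda>y. bil g y y) y = (\<Sum>a\<in>UNIV. (g c a + g a c) * y $ a)"
proof -
  have "pd c (\<lambda>y. bil g y y) y = (\<Sum>a\<in>UNIV. lower g a y * (if c = a then 1 else 0) + g a c * y $ a)"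
    unfolding bil_lower by (subst pd_sum) (auto simp: pd_mult pd_nth pd_lower)
  also have "\<dots> = lower g c y + (\<Sum>a\<in>UNIV. g a c * y $ a)"
    by (simp add: sum.distrib mult_delta_right)
  finally show ?thesis by (simp add: lower_def sum.distrib distrib_right)
qed

lemma pd_bil_symmetric: "scalar_product g \<Longrightarrow> pd c (\<lambda>y. bil g y y) y = 2 * lower g c y"
  unfolding pd_bil by (simp add: scalar_product_def lower_def sum_distrib_left mult.assoc)


section \<open>Symmetric solutions for a constant scalar product\<close>

text \<open>The affine equation for a Riemannian metric, at a fixed point of the manifold and after the
  reduction by symmetry. It is multiplied by \<open>L(y) = bil g y y\<close>.\<close>

locale symmetric_solution =
  fixes g :: "'n::finite \<Rightarrow> 'n \<Rightarrow> real" and J :: "'n \<Rightarrow> 'n \<Rightarrow> real^'n \<Rightarrow> real"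
  assumes dim: "CARD('n) \<ge> 3"
    and g: "scalar_product g"
    and smooth: "\<And>k i. smooth_on (- {0}) (J k i)"
    and homog: "\<And>k i y t. y \<noteq> 0 \<Longrightarrow> t > 0 \<Longrightarrow> J k i (t *\<^sub>R y) = t * J k i y"
    and symm: "\<And>k i j y. y \<noteq> 0 \<Longrightarrow> pd j (J k i) y = pd i (J k j) y"
    and equation: "\<And>b y. y \<noteq> 0 \<Longrightarrow>
      (real CARD('n) + 2) * (\<Sum>a\<in>UNIV. (\<Sum>c\<in>UNIV. g a c * y $ c) * J a b y)
      = 2 * bil g y y * (\<Sum>a\<in>UNIV. pd b (J a a) y)"
begin

definition f :: "real^'n \<Rightarrow> real" where "f y = (\<Sum>a\<in>UNIV. J a a y)"
definition Jy :: "'n \<Rightarrow> real^'n \<Rightarrow> real" where "Jy a y = (\<Sum>b\<in>UNIV. J a b y * y $ b)"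

lemma J_diff: "y \<noteq> 0 \<Longrightarrow> J k i differentiable at y"
  by (rule smooth_on_differentiable[OF smooth]) simp

lemma f_smooth: "smooth_on (- {0}) f"
  unfolding f_def[abs_def] by (intro smooth_on_sum open_slit smooth)

lemma f_diff: "y \<noteq> 0 \<Longrightarrow> f differentiable at y"
  by (rule smooth_on_differentiable[OF f_smooth]) simp

lemma pd_f_diff: "y \<noteq> 0 \<Longrightarrow> pd i f differentiable at y"
  by (rule smooth_on_differentiable[OF smooth_on_pd[OF f_smooth]]) simp

lemma pd_f: "y \<noteq> 0 \<Longrightarrow> pd b f y = (\<Sum>a\<in>UNIV. pd b (J a a) y)"
  unfolding f_def[abs_def] by (rule pd_sum) (simp add: J_diff)

lemma f_homog: "y \<noteq> 0 \<Longrightarrow> t > 0 \<Longrightarrow> f (t *\<^sub>R y) = t * f y"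
  by (simp add: f_def homog sum_distrib_left)

lemma f_euler: "y \<noteq> 0 \<Longrightarrow> (\<Sum>i\<in>UNIV. y $ i * pd i f y) = f y"
  by (rule euler_homogeneous) (simp_all add: f_diff f_homog)

lemma Jy_diff: "y \<noteq> 0 \<Longrightarrow> Jy a differentiable at y"
  unfolding Jy_def[abs_def] by (intro differentiable_sum differentiable_mult) (auto simp: J_diff)

text \<open>By symmetry and homogeneity, \<open>J\<close> is half the vertical derivative of \<open>Jy\<close>.\<close>

lemma pd_Jy: "y \<noteq> 0 \<Longrightarrow> pd c (Jy a) y = 2 * J a c y"
proof -
  assume y: "y \<noteq> 0"
  have "pd c (Jy a) y = (\<Sum>b\<in>UNIV. J a b y * (if c = b then 1 else 0) + pd c (J a b) y * y $ b)"
    unfolding Jy_def[abs_def] by (subst pd_sum) (auto simp: pd_mult pd_nth J_diff y)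
  also have "\<dots> = J a c y + (\<Sum>b\<in>UNIV. y $ b * pd b (J a c) y)"
    by (simp add: sum.distrib mult_delta_right symm[OF y, of c a] mult.commute)
  also have "(\<Sum>b\<in>UNIV. y $ b * pd b (J a c) y) = J a c y"
    by (rule euler_homogeneous) (simp_all add: y J_diff homog)
  finally show ?thesis by simp
qed

lemma equation_f: "y \<noteq> 0 \<Longrightarrow> (real CARD('n) + 2) * (\<Sum>a\<in>UNIV. lower g a y * J a b y) = 2 * bil g y y * pd b f y"
  using equation[of y b] by (simp add: pd_f lower_def)

text \<open>Contraction of the equation with \<open>y\<^sup>b\<close>; the right-hand side simplifies by Euler's relation.\<close>

lemma equation_contracted:
  assumes "y \<noteq> 0"
  shows "(real CARD('n) + 2) * (\<Sum>a\<in>UNIV. lower g a y * Jy a y) = 2 * (bil g y y * f y)"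
proof -
  have "(\<Sum>a\<in>UNIV. lower g a y * Jy a y) = (\<Sum>b\<in>UNIV. \<Sum>a\<in>UNIV. lower g a y * (J a b y * y $ b))"
    unfolding Jy_def sum_distrib_left by (rule sum.swap)
  also have "\<dots> = (\<Sum>b\<in>UNIV. y $ b * (\<Sum>a\<in>UNIV. lower g a y * J a b y))"
    by (simp add: sum_distrib_left mult_ac)
  finally have "(real CARD('n) + 2) * (\<Sum>a\<in>UNIV. lower g a y * Jy a y)
      = (\<Sum>b\<in>UNIV. y $ b * ((real CARD('n) + 2) * (\<Sum>a\<in>UNIV. lower g a y * J a b y)))"
    by (simp add: sum_distrib_left mult_ac)
  also have "\<dots> = (\<Sum>b\<in>UNIV. 2 * bil g y y * (y $ b * pd b f y))"
    by (intro sum.cong refl, simp only: equation_f[OF assms]) (simp only: mult_ac)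
  also have "\<dots> = 2 * bil g y y * f y"
    by (simp only: sum_distrib_left[symmetric] f_euler[OF assms])
  finally show ?thesis by simp
qed

text \<open>The vertical derivative of the contracted equation. The terms with \<open>y\<^sub>a J\<^sup>a\<^sub>c\<close> are eliminated by
  the equation itself, so that \<open>Jy\<close> is expressed through \<open>f\<close> and its first derivatives.\<close>

lemma lowered_Jy:
  assumes y: "y \<noteq> 0"
  shows "(real CARD('n) + 2) * (\<Sum>a\<in>UNIV. g a c * Jy a y) = 4 * lower g c y * f y - 2 * bil g y y * pd c f y"
proof -
  have "pd c (\<lambda>y. (real CARD('n) + 2) * (\<Sum>a\<in>UNIV. lower g a y * Jy a y)) y = pd c (\<lambda>y. 2 * (bil g y y * f y)) y"
    by (rule pd_cong[OF open_slit]) (use y equation_contracted in auto)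
  moreover have "pd c (\<lambda>y. (real CARD('n) + 2) * (\<Sum>a\<in>UNIV. lower g a y * Jy a y)) y
      = (real CARD('n) + 2) * (\<Sum>a\<in>UNIV. lower g a y * (2 * J a c y) + g a c * Jy a y)"
    by (subst pd_cmult) (auto simp: pd_sum pd_mult pd_lower pd_Jy Jy_diff y)
  moreover have "pd c (\<lambda>y. 2 * (bil g y y * f y)) y
      = 2 * (bil g y y * pd c f y + 2 * lower g c y * f y)"
    by (subst pd_cmult) (auto simp: pd_mult pd_bil_symmetric[OF g] f_diff y)
  moreover have "(real CARD('n) + 2) * (\<Sum>a\<in>UNIV. lower g a y * (2 * J a c y) + g a c * Jy a y)
      = 2 * ((real CARD('n) + 2) * (\<Sum>a\<in>UNIV. lower g a y * J a c y)) + (real CARD('n) + 2) * (\<Sum>a\<in>UNIV. g a c * Jy a y)"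
    by (simp only: sum.distrib distrib_left sum_distrib_left mult_ac)
  ultimately show ?thesis using equation_f[OF y, of c] by (simp add: algebra_simps)
qed

context
  fixes E :: "'n \<Rightarrow> real^'n"
  assumes E: "\<And>c d. bil g (E c) (E d) = (if c = d then 1 else 0)"
begin

text \<open>\<open>P\<close> is the inverse of \<open>g\<close>, written as a sum over the frame; in this form the contraction with a Hessian
  is the sum of the second derivatives in the directions of the frame.\<close>

definition P :: "'n \<Rightarrow> 'n \<Rightarrow> real" where "P a b = (\<Sum>c\<in>UNIV. E c $ a * E c $ b)"

lemma P_inverse: "(\<Sum>b\<in>UNIV. g a b * P b d) = (if a = d then 1 else 0)"
  unfolding P_def by (rule orthonormal_frame_inverse[OF E])

lemma P_commute: "P a b = P b a" by (simp add: P_def mult.commute)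

lemma raise: "(\<Sum>c\<in>UNIV. P d c * (\<Sum>a\<in>UNIV. g a c * w a)) = w d"
proof -
  have "(\<Sum>c\<in>UNIV. P d c * (\<Sum>a\<in>UNIV. g a c * w a)) = (\<Sum>c\<in>UNIV. \<Sum>a\<in>UNIV. w a * (g a c * P c d))"
    by (simp add: sum_distrib_left P_commute[of d] mult_ac)
  also have "\<dots> = (\<Sum>a\<in>UNIV. w a * (\<Sum>c\<in>UNIV. g a c * P c d))"
    unfolding sum_distrib_left by (rule sum.swap)
  also have "\<dots> = w d" by (simp add: P_inverse mult_delta_right)
  finally show ?thesis .
qed

lemma raise_lower: "(\<Sum>c\<in>UNIV. P d c * lower g c y) = y $ d"
  using raise[of d "\<lambda>a. y $ a"] g by (simp add: lower_def scalar_product_def)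

lemma Jy_eq:
  assumes y: "y \<noteq> 0"
  shows "(real CARD('n) + 2) * Jy d y
    = 4 * (y $ d * f y) - 2 * (bil g y y * (\<Sum>c\<in>UNIV. P d c * pd c f y))"
proof -
  have "(real CARD('n) + 2) * Jy d y
      = (\<Sum>c\<in>UNIV. P d c * ((real CARD('n) + 2) * (\<Sum>a\<in>UNIV. g a c * Jy a y)))"
    using raise[of d "\<lambda>a. (real CARD('n) + 2) * Jy a y"] by (simp add: sum_distrib_left mult_ac)
  also have "\<dots> = (\<Sum>c\<in>UNIV. 4 * f y * (P d c * lower g c y) - 2 * bil g y y * (P d c * pd c f y))"
    by (intro sum.cong refl) (simp only: lowered_Jy[OF y] right_diff_distrib mult_ac)
  also have "\<dots> = 4 * f y * y $ d - 2 * bil g y y * (\<Sum>c\<in>UNIV. P d c * pd c f y)"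
    by (simp only: sum_subtractf sum_distrib_left[symmetric] raise_lower)
  finally show ?thesis by simp
qed

text \<open>The vertical derivative of the formula for \<open>Jy\<close>. It shows that \<open>J\<close> vanishes as soon as its trace
  does.\<close>

lemma J_eq:
  assumes y: "y \<noteq> 0"
  shows "2 * (real CARD('n) + 2) * J d e y =
    4 * (y $ d * pd e f y + (if e = d then f y else 0))
    - 2 * (bil g y y * (\<Sum>c\<in>UNIV. P d c * pd e (pd c f) y)
      + 2 * lower g e y * (\<Sum>c\<in>UNIV. P d c * pd c f y))"
proof -
  have "pd e (\<lambda>y. (real CARD('n) + 2) * Jy d y) y
      = pd e (\<lambda>y. 4 * (y $ d * f y) - 2 * (bil g y y * (\<Sum>c\<in>UNIV. P d c * pd c f y))) y"
    by (rule pd_cong[OF open_slit]) (use y Jy_eq in auto)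
  moreover have "pd e (\<lambda>y. (real CARD('n) + 2) * Jy d y) y = 2 * (real CARD('n) + 2) * J d e y"
    by (simp add: pd_cmult Jy_diff pd_Jy y)
  moreover have ds: "(\<lambda>y. \<Sum>c\<in>UNIV. P d c * pd c f y) differentiable at y"
    by (intro differentiable_sum differentiable_mult) (auto simp: pd_f_diff y)
  moreover have "pd e (\<lambda>y. \<Sum>c\<in>UNIV. P d c * pd c f y) y = (\<Sum>c\<in>UNIV. P d c * pd e (pd c f) y)"
    by (subst pd_sum) (auto simp: pd_f_diff y pd_cmult)
  moreover have "pd e (\<lambda>y. 4 * (y $ d * f y) - 2 * (bil g y y * (\<Sum>c\<in>UNIV. P d c * pd c f y))) y
     = 4 * pd e (\<lambda>y. y $ d * f y) y - 2 * pd e (\<lambda>y. bil g y y * (\<Sum>c\<in>UNIV. P d c * pd c f y)) y"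
    by (subst pd_diff) (use ds in \<open>auto simp: pd_cmult f_diff y\<close>)
  ultimately show ?thesis
    by (simp add: pd_mult f_diff y pd_nth pd_bil_symmetric[OF g])
qed

text \<open>Taking the trace of the formula for \<open>J\<close> turns it into an equation for \<open>f\<close> alone.\<close>

lemma f_pde:
  assumes y: "y \<noteq> 0"
  shows "bil g y y * (\<Sum>d\<in>UNIV. \<Sum>c\<in>UNIV. P d c * pd d (pd c f) y) = (real CARD('n) - 2) * f y"
proof -
  let ?n = "real CARD('n)"
  have 1: "(\<Sum>d\<in>UNIV. lower g d y * (\<Sum>c\<in>UNIV. P d c * pd c f y)) = f y"
  proof -
    have "(\<Sum>d\<in>UNIV. lower g d y * (\<Sum>c\<in>UNIV. P d c * pd c f y))
        = (\<Sum>d\<in>UNIV. \<Sum>c\<in>UNIV. pd c f y * (P c d * lower g d y))"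
      by (simp add: sum_distrib_left P_commute mult_ac)
    also have "\<dots> = (\<Sum>c\<in>UNIV. pd c f y * (\<Sum>d\<in>UNIV. P c d * lower g d y))"
      unfolding sum_distrib_left by (rule sum.swap)
    finally show ?thesis unfolding raise_lower using f_euler[OF y] by (simp add: mult.commute)
  qed
  have "2 * (?n + 2) * f y = (\<Sum>d\<in>UNIV. 2 * (?n + 2) * J d d y)"
    by (simp add: f_def sum_distrib_left)
  also have "\<dots> = (\<Sum>d\<in>UNIV. 4 * (y $ d * pd d f y) + 4 * f y
      - 2 * bil g y y * (\<Sum>c\<in>UNIV. P d c * pd d (pd c f) y)
      - 4 * (lower g d y * (\<Sum>c\<in>UNIV. P d c * pd c f y)))"
    by (intro sum.cong refl, simp only: J_eq[OF y]) (simp add: algebra_simps)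
  also have "\<dots> = 4 * f y + 4 * ?n * f y
      - 2 * bil g y y * (\<Sum>d\<in>UNIV. \<Sum>c\<in>UNIV. P d c * pd d (pd c f) y) - 4 * f y"
    by (simp only: sum_subtractf sum.distrib sum_distrib_left[symmetric] f_euler[OF y] 1) simp
  finally show ?thesis by (simp add: algebra_simps)
qed

text \<open>In the coordinates of the frame the equation for \<open>f\<close> becomes the one for the Euclidean
  scalar product.\<close>

lemma f_eq_0:
  assumes "y \<noteq> 0" shows "f y = 0"
proof -
  define T :: "real^'n \<Rightarrow> real^'n" where "T = (\<lambda>u. \<Sum>c\<in>UNIV. u $ c *\<^sub>R E c)"
  have "linear T" unfolding T_def
    by (rule linearI) (simp_all add: sum.distrib algebra_simps scaleR_sum_right)
  then have T: "(T has_derivative T) (at u)" for u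
    by (simp add: bounded_linear_imp_has_derivative linear_conv_bounded_linear)
  have T_axis: "T (axis c 1) = E c" for c
    by (simp add: T_def axis_def if_distrib[of "\<lambda>x. x *\<^sub>R _"] cong: if_cong)
  have TT: "bil g (T u) (T u) = u \<bullet> u" for u
  proof -
    show ?thesis
      by (simp add: T_def linear_sum[OF linear_bil_left] linear_sum[OF linear_bil_right]
          linear_cmul[OF linear_bil_left] linear_cmul[OF linear_bil_right] E mult_delta_right inner_vec_def)
  qed
  have T0: "T u \<noteq> 0" if "u \<noteq> 0" for u
  proof
    assume "T u = 0"
    then have "u \<bullet> u = 0" using TT[of u] linear_0[OF linear_bil_left] by metis
    then show False using that by simp
  qed
  define F1 where "F1 = (\<lambda>u v. \<Sum>a\<in>UNIV. T v $ a * pd a f (T u))"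
  define F2 where "F2 = (\<lambda>u v w. \<Sum>a\<in>UNIV. T v $ a * (\<Sum>b\<in>UNIV. T w $ b * pd b (pd a f) (T u)))"
  interpret sphere_eigenfunction "\<lambda>u. f (T u)" F1 F2
  proof
    show "3 \<le> DIM(real^'n)" using dim by simp
    fix u :: "real^'n" assume u: "u \<noteq> 0"
    show "((\<lambda>u. f (T u)) has_derivative F1 u) (at u)"
      unfolding F1_def by (rule has_derivative_compose[OF T has_derivative_pd[OF f_diff[OF T0[OF u]]]])
    show "((\<lambda>z. F1 z v) has_derivative F2 u v) (at u)" for v
      unfolding F1_def F2_def
      by (intro has_derivative_sum has_derivative_mult_right
          has_derivative_compose[OF T has_derivative_pd[OF pd_f_diff[OF T0[OF u]]]])
    show "f (T (t *\<^sub>R u)) = t * f (T u)" if "t > 0" for t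
      using f_homog[OF T0[OF u] that] by (simp add: linear_cmul[OF \<open>linear T\<close>])
    have "(\<Sum>b\<in>Basis. F2 u b b) = (\<Sum>c\<in>UNIV. F2 u (axis c 1) (axis c 1))"
    proof -
      have B: "(Basis :: (real^'n) set) = (\<lambda>c. axis c 1) ` UNIV" by (auto simp: Basis_vec_def)
      have inj: "inj (\<lambda>c::'n. axis c (1::real))" by (simp add: inj_on_def axis_eq_axis)
      show ?thesis unfolding B by (subst sum.reindex[OF inj]) (simp only: o_def)
    qed
    also have "\<dots> = (\<Sum>c\<in>UNIV. \<Sum>a\<in>UNIV. \<Sum>b\<in>UNIV. E c $ a * E c $ b * pd b (pd a f) (T u))"
      by (simp add: F2_def T_axis sum_distrib_left mult_ac)
    also have "\<dots> = (\<Sum>a\<in>UNIV. \<Sum>b\<in>UNIV. \<Sum>c\<in>UNIV. E c $ a * E c $ b * pd b (pd a f) (T u))"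
      by (rule trans[OF sum.swap], rule sum.cong[OF refl], rule sum.swap)
    also have "\<dots> = (\<Sum>a\<in>UNIV. \<Sum>b\<in>UNIV. P b a * pd b (pd a f) (T u))"
      by (simp only: P_def sum_distrib_right) (simp only: mult_ac)
    also have "\<dots> = (\<Sum>d\<in>UNIV. \<Sum>c\<in>UNIV. P d c * pd d (pd c f) (T u))" by (rule sum.swap)
    finally show "(u \<bullet> u) * (\<Sum>b\<in>Basis. F2 u b b) = (real DIM(real^'n) - 2) * f (T u)"
      using f_pde[OF T0[OF u]] by (simp add: TT)
  qed
  define u where "u = (\<chi> c. \<Sum>a\<in>UNIV. lower g a y * E c $ a)"
  have "T u = y"
  proof -
    have "T u $ d = y $ d" for d
    proof -
      have "T u $ d = (\<Sum>c\<in>UNIV. \<Sum>a\<in>UNIV. lower g a y * (E c $ d * E c $ a))"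
        by (simp add: T_def u_def sum_distrib_left sum_distrib_right mult_ac)
      also have "\<dots> = (\<Sum>a\<in>UNIV. P d a * lower g a y)"
        unfolding P_def sum_distrib_right by (subst sum.swap) (simp add: mult_ac)
      finally show ?thesis by (simp add: raise_lower)
    qed
    then show ?thesis by (simp add: vec_eq_iff)
  qed
  moreover have "u \<noteq> 0" using \<open>T u = y\<close> assms linear_0[OF \<open>linear T\<close>] by metis
  ultimately show ?thesis using eq_0[of u] by simp
qed

end

theorem J_eq_0:
  assumes y: "y \<noteq> 0" shows "J k i y = 0"
proof -
  obtain E :: "'n \<Rightarrow> real^'n" where E: "\<And>c d. bil g (E c) (E d) = (if c = d then 1 else 0)"
    using orthonormal_frame_exists[OF g] by metis
  have f: "f z = 0" if "z \<noteq> 0" for z using f_eq_0[OF E that] .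
  have f': "pd c f z = 0" if "z \<noteq> 0" for c z
    using pd_cong[OF open_slit, of z f "\<lambda>_. 0" c] f that by simp
  have f'': "pd e (pd c f) y = 0" for c e
    using pd_cong[OF open_slit, of y "pd c f" "\<lambda>_. 0" e] f' y by simp
  show ?thesis using J_eq[OF E y, of k i] f[OF y] by (cases "i = k") (simp_all add: f'[OF y] f'')
qed

end

section \<open>Riemannian metrics in a coordinate domain\<close>

lemma scalar_product_nondegenerate:
  assumes "scalar_product g" "\<And>j. (\<Sum>a\<in>UNIV. v a * g a j) = 0"
  shows "v a = 0"
proof -
  have "bil g (\<chi> a. v a) (\<chi> a. v a) = (\<Sum>j\<in>UNIV. v j * (\<Sum>a\<in>UNIV. v a * g a j))"
    unfolding bil_def sum_distrib_left by (subst sum.swap) (simp add: mult_ac)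
  then have "(\<chi> a. v a) = 0" using assms unfolding scalar_product_def by fastforce
  then show ?thesis by (simp add: vec_eq_iff)
qed

text \<open>The uniqueness of the Levi-Civita connection, at a point: \<open>D k i j\<close> stands for
  \<open>\<partial>\<^sub>kg\<^sub>i\<^sub>j\<close>. The lowered difference of two candidates is symmetric in its first two and
  skew-symmetric in its last two arguments, hence zero.\<close>

lemma levi_civita_unique:
  fixes g :: "'n::finite \<Rightarrow> 'n \<Rightarrow> real"
  assumes g: "scalar_product g"
    and sym: "\<And>a i j. \<Gamma> a i j = \<Gamma> a j i" "\<And>a i j. \<Gamma>' a i j = \<Gamma>' a j i"
    and compat: "\<And>k i j. D k i j = (\<Sum>a\<in>UNIV. \<Gamma> a k i * g a j) + (\<Sum>a\<in>UNIV. \<Gamma> a k j * g a i)"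
      "\<And>k i j. D k i j = (\<Sum>a\<in>UNIV. \<Gamma>' a k i * g a j) + (\<Sum>a\<in>UNIV. \<Gamma>' a k j * g a i)"
  shows "\<Gamma> a k i = \<Gamma>' a k i"
proof -
  define S where "S k i j = (\<Sum>a\<in>UNIV. (\<Gamma> a k i - \<Gamma>' a k i) * g a j)" for k i j
  have S_sym: "S k i j = S i k j" for k i j by (simp add: S_def sym(1)[of _ k] sym(2)[of _ k])
  have S_skew: "S k i j = - S k j i" for k i j
    using compat[of k i j] by (simp add: S_def sum_subtractf left_diff_distrib)
  have "S k i j = 0" for k i j
    using S_skew[of k i j] S_sym[of k j i] S_skew[of j k i] S_sym[of j i k] S_skew[of i j k]
      S_sym[of i k j] by linarith
  then have "\<Gamma> a k i - \<Gamma>' a k i = 0"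
    by (intro scalar_product_nondegenerate[OF g, of "\<lambda>a. \<Gamma> a k i - \<Gamma>' a k i"]) (simp add: S_def)
  then show ?thesis by simp
qed

text \<open>The coordinate domain of a chart with the components \<open>G\<close> of a Riemannian metric. The function
  \<open>l\<close> is constrained off the zero section only. Since the slit tangent space is open, this
  determines its vertical derivatives there.\<close>

locale riemannian_coordinates =
  fixes U :: "(real^'n::finite) set" and G :: "'n \<Rightarrow> 'n \<Rightarrow> real^'n \<Rightarrow> real" and l :: "'n cfun"
  assumes open_U: "open U"
    and G_smooth: "\<And>a b. smooth_on U (G a b)"
    and G_scalar_product: "\<And>x. x \<in> U \<Longrightarrow> scalar_product (\<lambda>a b. G a b x)"
    and l_eq: "\<And>x y. x \<in> U \<Longrightarrow> y \<noteq> 0 \<Longrightarrow> l x y = bil (\<lambda>a b. G a b x) y y"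
begin

definition Ginv :: "'n \<Rightarrow> 'n \<Rightarrow> real^'n \<Rightarrow> real" where
  "Ginv i j x = matrix_inv (\<chi> a b. G a b x) $ i $ j"

text \<open>The Christoffel symbols \<open>\<Gamma>\<^sup>k\<^sub>i\<^sub>j\<close> of the Levi-Civita connection.\<close>

definition chris :: "'n \<Rightarrow> 'n \<Rightarrow> 'n \<Rightarrow> real^'n \<Rightarrow> real" where
  "chris k i j x = 1/2 * (\<Sum>a\<in>UNIV. Ginv k a x * (pd j (G a i) x + pd i (G a j) x - pd a (G i j) x))"

lemma G_commute: "x \<in> U \<Longrightarrow> G i j x = G j i x"
  using G_scalar_product unfolding scalar_product_def by blast

lemma pd_G_commute: "x \<in> U \<Longrightarrow> pd k (G i j) x = pd k (G j i) x"
  by (rule pd_cong[OF open_U]) (auto intro: G_commute)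

lemma G_Ginv: "x \<in> U \<Longrightarrow> (\<Sum>b\<in>UNIV. G a b x * Ginv b c x) = (if a = c then 1 else 0)"
proof -
  assume x: "x \<in> U"
  let ?M = "\<chi> a b. G a b x"
  have "?M ** matrix_inv ?M = mat 1"
    using matrix_inv_inverse(1)[OF scalar_product_invertible[OF G_scalar_product[OF x]]] .
  then have "(?M ** matrix_inv ?M) $ a $ c = mat 1 $ a $ c" by simp
  then show ?thesis by (simp add: matrix_matrix_mult_def mat_def Ginv_def)
qed

lemma chris_smooth: "smooth_on U (chris k i j)"
proof -
  have "smooth_on U (Ginv i j)" for i j
    unfolding Ginv_def[abs_def]
    by (intro smooth_on_matrix_inv open_U G_smooth scalar_product_invertible G_scalar_product)
  then show ?thesis unfolding chris_def[abs_def]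
    by (intro smooth_on_mult smooth_on_sum smooth_on_const smooth_on_diff smooth_on_add
        smooth_on_pd open_U G_smooth)
qed

lemma chris_commute: "x \<in> U \<Longrightarrow> chris k i j x = chris k j i x"
  by (simp add: chris_def pd_G_commute[of x _ i j] add.commute)

lemma chris_lower:
  assumes x: "x \<in> U"
  shows "(\<Sum>a\<in>UNIV. chris a k i x * G a j x) = 1/2 * (pd i (G j k) x + pd k (G j i) x - pd j (G k i) x)"
proof -
  let ?D = "\<lambda>b. pd i (G b k) x + pd k (G b i) x - pd b (G k i) x"
  have "(\<Sum>a\<in>UNIV. chris a k i x * G a j x) = (\<Sum>a\<in>UNIV. \<Sum>b\<in>UNIV. 1/2 * ?D b * (G j a x * Ginv a b x))"
    by (simp only: chris_def sum_distrib_left sum_distrib_right G_commute[OF x, of _ j]) (simp add: mult_ac)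
  also have "\<dots> = (\<Sum>b\<in>UNIV. 1/2 * ?D b * (\<Sum>a\<in>UNIV. G j a x * Ginv a b x))"
    unfolding sum_distrib_left by (rule sum.swap)
  also have "\<dots> = 1/2 * ?D j" by (simp only: G_Ginv[OF x]) (simp add: mult_delta_right)
  finally show ?thesis .
qed

lemma chris_compatible:
  assumes x: "x \<in> U"
  shows "pd k (G i j) x = (\<Sum>a\<in>UNIV. chris a k i x * G a j x) + (\<Sum>a\<in>UNIV. chris a k j x * G a i x)"
  unfolding chris_lower[OF x]
  using pd_G_commute[OF x, of k i j] pd_G_commute[OF x, of i j k] pd_G_commute[OF x, of j k i]
  by (simp add: field_simps)

lemma dy_l: "x \<in> U \<Longrightarrow> y \<noteq> 0 \<Longrightarrow> dy i l x y = 2 * lower (\<lambda>a b. G a b x) i y"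
  unfolding dy_def
  by (subst pd_bil_symmetric[symmetric, OF G_scalar_product], assumption)
    (rule pd_cong[OF open_slit], auto simp: l_eq)

lemma gf_eq: "x \<in> U \<Longrightarrow> y \<noteq> 0 \<Longrightarrow> gf l i j x y = G i j x"
proof -
  assume x: "x \<in> U" and y: "y \<noteq> 0"
  have "dy j (dy i l) x y = pd j (\<lambda>y. 2 * lower (\<lambda>a b. G a b x) i y) y"
    unfolding dy_def[of j] by (rule pd_cong[OF open_slit]) (use x y dy_l in auto)
  then show ?thesis by (simp add: gf_def pd_cmult pd_lower)
qed

lemma gf_inv_eq: "x \<in> U \<Longrightarrow> y \<noteq> 0 \<Longrightarrow> gf_inv l i j x y = Ginv i j x"
  by (simp add: gf_inv_def Ginv_def gf_eq)

lemma y_low_eq: "x \<in> U \<Longrightarrow> y \<noteq> 0 \<Longrightarrow> y_low l i x y = lower (\<lambda>a b. G a b x) i y"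
  by (simp add: y_low_def gf_eq lower_def)

lemma dx_gf: "x \<in> U \<Longrightarrow> y \<noteq> 0 \<Longrightarrow> dx k (gf l i j) x y = pd k (G i j) x"
  unfolding dx_def by (rule pd_cong[OF open_U]) (auto simp: gf_eq)

lemma dy_gf: "x \<in> U \<Longrightarrow> y \<noteq> 0 \<Longrightarrow> dy k (gf l i j) x y = 0"
proof -
  assume "x \<in> U" "y \<noteq> 0"
  then have "dy k (gf l i j) x y = pd k (\<lambda>y. G i j x) y"
    unfolding dy_def by (intro pd_cong[OF open_slit]) (auto simp: gf_eq)
  then show ?thesis by simp
qed

lemma mean_cartan_eq_0: "x \<in> U \<Longrightarrow> y \<noteq> 0 \<Longrightarrow> mean_cartan l i x y = 0"
  by (simp add: mean_cartan_def cartan_def dy_gf)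

text \<open>The spray is the quadratic form in \<open>y\<close> of a matrix \<open>K\<close>, and its vertical derivative is given by
  \<open>K + K\<^sup>T\<close>, which consists of the Christoffel symbols.\<close>

lemma NL_eq:
  assumes x: "x \<in> U" and y: "y \<noteq> 0"
  shows "NL l k i x y = (\<Sum>c\<in>UNIV. chris k i c x * y $ c)"
proof -
  define K where "K b c = 1/4 * (\<Sum>a\<in>UNIV. Ginv k a x * (2 * pd c (G a b) x - pd a (G b c) x))" for b c
  have spray: "spray l k x z = bil K z z" if "z \<noteq> 0" for z
  proof -
    have "spray l k x z = 1/4 * (\<Sum>a\<in>UNIV. \<Sum>b\<in>UNIV. \<Sum>c\<in>UNIV.
        Ginv k a x * (2 * pd c (G a b) x - pd a (G b c) x) * z $ b * z $ c)"
      using x that by (simp add: spray_def gf_inv_eq dx_gf)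
    also have "(\<Sum>a\<in>UNIV. \<Sum>b\<in>UNIV. \<Sum>c\<in>UNIV.
        Ginv k a x * (2 * pd c (G a b) x - pd a (G b c) x) * z $ b * z $ c) =
      (\<Sum>b\<in>UNIV. \<Sum>c\<in>UNIV. \<Sum>a\<in>UNIV.
        Ginv k a x * (2 * pd c (G a b) x - pd a (G b c) x) * z $ b * z $ c)"
      by (rule trans[OF sum.swap], rule sum.cong[OF refl], rule sum.swap)
    finally show ?thesis
      by (simp only: bil_def K_def sum_distrib_left sum_distrib_right) (simp only: mult_ac)
  qed
  have "NL l k i x y = pd i (\<lambda>z. bil K z z) y"
    unfolding NL_def dy_def by (rule pd_cong[OF open_slit]) (use y spray in auto)
  also have "\<dots> = (\<Sum>c\<in>UNIV. (K i c + K c i) * y $ c)" by (rule pd_bil)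
  finally have "NL l k i x y = (\<Sum>c\<in>UNIV. (K i c + K c i) * y $ c)" .
  moreover have "K i c + K c i = chris k i c x" for c
  proof -
    have "K i c + K c i = (\<Sum>a\<in>UNIV. 1/4 * (Ginv k a x * (2 * pd c (G a i) x - pd a (G i c) x))
        + 1/4 * (Ginv k a x * (2 * pd i (G a c) x - pd a (G c i) x)))"
      by (simp only: K_def sum.distrib sum_distrib_left)
    also have "\<dots> = chris k i c x"
      unfolding chris_def sum_distrib_left
      by (rule sum.cong[OF refl]) (simp add: pd_G_commute[OF x, of _ c i] algebra_simps)
    finally show ?thesis .
  qed
  ultimately show ?thesis by simp
qed

lemma dy_NL:
  assumes x: "x \<in> U" and y: "y \<noteq> 0"
  shows "dy j (NL l k i) x y = chris k i j x"
proof -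
  have "dy j (NL l k i) x y = pd j (lower (\<lambda>i c. chris k i c x) i) y"
    unfolding dy_def by (rule pd_cong[OF open_slit]) (use x y NL_eq in \<open>auto simp: lower_def\<close>)
  then show ?thesis by (simp add: pd_lower)
qed

text \<open>With \<open>N\<^sup>L\<close> given by the Christoffel symbols, \<open>landsberg\<close> is half the covariant derivative of the
  metric.\<close>

lemma mean_landsberg_eq_0:
  assumes x: "x \<in> U" and y: "y \<noteq> 0"
  shows "mean_landsberg l i x y = 0"
proof -
  have "landsberg l i j k x y = 0" for i j k
    using chris_compatible[OF x, of k i j]
    by (simp add: landsberg_def dx_gf dy_gf dy_NL gf_eq x y G_commute[OF x, of i])
  then show ?thesis by (simp add: mean_landsberg_def)
qed

lemma NL_smooth: "smooth_on (U \<times> - {0}) (\<lambda>(x, y). NL l k i x y)"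
proof -
  have S: "open (U \<times> - {0::real^'n})" by (intro open_Times open_U open_slit)
  have "smooth_on (U \<times> - {0}) (\<lambda>z. \<Sum>c\<in>UNIV. chris k i c (fst z) * snd z $ c)"
  proof (intro smooth_on_sum smooth_on_mult S)
    fix c
    have "smooth_on (U \<times> - {0::real^'n}) (\<lambda>z. chris k i c (0 + fst z))"
      by (rule smooth_on_compose_affine[OF S bounded_linear_fst _ chris_smooth]) auto
    then show "smooth_on (U \<times> - {0::real^'n}) (\<lambda>z. chris k i c (fst z))" by simp
    have "bounded_linear (\<lambda>z::(real^'n) \<times> (real^'n). snd z $ c)"
      by (rule bounded_linear_compose[OF bounded_linear_vec_nth bounded_linear_snd])
    then show "smooth_on (U \<times> - {0}) (\<lambda>z::(real^'n) \<times> (real^'n). snd z $ c)"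
      by (rule smooth_on_bounded_linear[OF S])
  qed
  moreover have eq: "(case z of (x, y) \<Rightarrow> NL l k i x y) = (\<Sum>c\<in>UNIV. chris k i c (fst z) * snd z $ c)"
    if "z \<in> U \<times> - {0}" for z
    using that by (cases z) (simp add: NL_eq)
  ultimately show ?thesis by (simp only: smooth_on_cong[OF S eq])
qed

lemma NL_homog: "x \<in> U \<Longrightarrow> y \<noteq> 0 \<Longrightarrow> t > 0 \<Longrightarrow> NL l k i x (t *\<^sub>R y) = t * NL l k i x y"
  by (simp add: NL_eq sum_distrib_left mult_ac)

lemma affine_lhs_zero: "x \<in> U \<Longrightarrow> y \<noteq> 0 \<Longrightarrow> affine_lhs l (\<lambda>_ _ _ _. 0) i j x y = 0"
  by (simp add: affine_lhs_def affine_covector_def mean_landsberg_eq_0 dy_def)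

text \<open>For symmetric \<open>J\<close> the last term of the affine equation vanishes, and a covector \<open>V\<close>
  with \<open>V\<^sub>i y\<^sup>j = V\<^sub>b y\<^sup>b \<delta>\<^sup>j\<^sub>i\<close> is zero in dimension at least two: the trace gives
  \<open>V\<^sub>b y\<^sup>b = 0\<close>, and \<open>y \<noteq> 0\<close>.\<close>

lemma symmetric_solution_eq_0:
  assumes dim: "CARD('n) \<ge> 3" and x: "x \<in> U"
    and smooth: "\<And>k i. smooth_on (- {0}) (J k i x)"
    and homog: "\<And>k i y t. y \<noteq> 0 \<Longrightarrow> t > 0 \<Longrightarrow> J k i x (t *\<^sub>R y) = t * J k i x y"
    and symm: "\<And>k i j y. y \<noteq> 0 \<Longrightarrow> dy j (J k i) x y = dy i (J k j) x y"
    and eq: "\<And>i j y. y \<noteq> 0 \<Longrightarrow> affine_lhs l J i j x y = 0"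
    and y: "y \<noteq> 0"
  shows "J k i x y = 0"
proof -
  let ?g = "\<lambda>a b. G a b x"
  interpret symmetric_solution ?g "\<lambda>k i. J k i x"
  proof
    show "3 \<le> CARD('n)" by (rule dim)
    show "scalar_product ?g" by (rule G_scalar_product[OF x])
    show "smooth_on (- {0}) (J k i x)" for k i by (rule smooth)
    fix y :: "real^'n" and b assume y: "y \<noteq> 0"
    show "J k i x (t *\<^sub>R y) = t * J k i x y" if "t > 0" for k i t by (rule homog[OF y that])
    show "pd j (J k i x) y = pd i (J k j x) y" for k i j using symm[OF y] by (simp add: dy_def)
    let ?V = "\<lambda>b. affine_covector l J b x y"
    have V: "?V i * y $ j = (if j = i then \<Sum>b\<in>UNIV. ?V b * y $ b else 0)" for i j
    proof -
      have "(\<Sum>a\<in>UNIV. (dy a (J j i) x y - dy i (J j a) x y) * y $ a) = 0"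
        by (simp add: symm[OF y, of _ j i])
      then have "affine_lhs l J i j x y = (\<Sum>b\<in>UNIV. (if b = i then ?V b * y $ j else 0)
          - (if j = i then ?V b * y $ b else 0))"
        by (simp only: affine_lhs_def diff_zero, intro sum.cong refl) (simp add: algebra_simps)
      also have "\<dots> = ?V i * y $ j - (if j = i then \<Sum>b\<in>UNIV. ?V b * y $ b else 0)"
        by (simp add: sum_subtractf)
      finally show ?thesis using eq[OF y] by simp
    qed
    define W where "W = (\<Sum>b\<in>UNIV. ?V b * y $ b)"
    have V': "?V i * y $ j = (if j = i then W else 0)" for i j
      unfolding W_def by (rule V)
    have "W = (\<Sum>i\<in>(UNIV :: 'n set). W)"
      by (subst (1) W_def) (simp add: V')
    then have "W = 0" using dim by simp
    moreover obtain j where "y $ j \<noteq> 0" using y by (auto simp: vec_eq_iff)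
    ultimately have "?V b = 0" using V'[of b j] by (auto split: if_splits)
    moreover have "?V b = (real CARD('n) + 2) * (\<Sum>a\<in>UNIV. lower ?g a y / bil ?g y y * J a b x y)
        - 2 * (\<Sum>a\<in>UNIV. pd b (J a a x) y)"
    proof -
      have "(\<Sum>a\<in>UNIV. dy a (J a b) x y + dy b (J a a) x y) = (\<Sum>a\<in>UNIV. 2 * pd b (J a a x) y)"
        by (rule sum.cong[OF refl], subst symm[OF y]) (simp add: dy_def)
      then show ?thesis
        unfolding affine_covector_def mean_landsberg_eq_0[OF x y] mean_cartan_eq_0[OF x y]
          y_low_eq[OF x y] l_eq[OF x y]
        by (simp add: sum_distrib_left)
    qed
    moreover have "(\<Sum>a\<in>UNIV. lower ?g a y / bil ?g y y * J a b x y)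
        = (\<Sum>a\<in>UNIV. lower ?g a y * J a b x y) / bil ?g y y"
      by (simp add: sum_divide_distrib)
    ultimately have "(real CARD('n) + 2) * ((\<Sum>a\<in>UNIV. lower ?g a y * J a b x y) / bil ?g y y)
        - 2 * (\<Sum>a\<in>UNIV. pd b (J a a x) y) = 0" by simp
    moreover have "bil ?g y y > 0"
      using G_scalar_product[OF x] y by (simp add: scalar_product_def)
    ultimately have "(real CARD('n) + 2) * (\<Sum>a\<in>UNIV. lower ?g a y * J a b x y)
        = 2 * bil ?g y y * (\<Sum>a\<in>UNIV. pd b (J a a x) y)"
      by (simp add: field_simps)
    then show "(real CARD('n) + 2) * (\<Sum>a\<in>UNIV. (\<Sum>c\<in>UNIV. G a c x * y $ c) * J a b x y)
      = 2 * bil ?g y y * (\<Sum>a\<in>UNIV. pd b (J a a x) y)"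
      by (simp add: lower_def)
  qed
  show ?thesis using J_eq_0[OF y] .
qed

end

section \<open>Transformation of the Levi-Civita connection\<close>

text \<open>The transformation law of the Christoffel symbols, at a point: \<open>Psi i\<close> is the
  \<open>i\<close>-th column of the Jacobian of the old coordinates with respect to the new ones, \<open>H\<close> the
  second derivative, \<open>\<Phi>\<close> the inverse Jacobian. The transformed symbols are symmetric and
  compatible with the transformed metric, so that they are the Levi-Civita symbols by uniqueness;
  this avoids a computation with the inverse metric.\<close>

lemma christoffel_transformation:
  fixes g g' \<Phi> :: "'n::finite \<Rightarrow> 'n \<Rightarrow> real" and \<Gamma> \<Gamma>' D D' :: "'n \<Rightarrow> 'n \<Rightarrow> 'n \<Rightarrow> real"
    and Psi :: "'n \<Rightarrow> real^'n" and H :: "'n \<Rightarrow> 'n \<Rightarrow> real^'n"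
  assumes g: "scalar_product g" and g': "scalar_product g'"
    and \<Gamma>_sym: "\<And>a i j. \<Gamma> a i j = \<Gamma> a j i" and \<Gamma>'_sym: "\<And>a i j. \<Gamma>' a i j = \<Gamma>' a j i"
    and H_sym: "\<And>i j. H i j = H j i"
    and compat: "\<And>k i j. D k i j = (\<Sum>a\<in>UNIV. \<Gamma> a k i * g a j) + (\<Sum>a\<in>UNIV. \<Gamma> a k j * g a i)"
    and compat': "\<And>k i j. D' k i j = (\<Sum>a\<in>UNIV. \<Gamma>' a k i * g' a j) + (\<Sum>a\<in>UNIV. \<Gamma>' a k j * g' a i)"
    and g'_eq: "\<And>i j. g' i j = bil g (Psi i) (Psi j)"
    and D'_eq: "\<And>k i j. D' k i j = (\<Sum>p\<in>UNIV. Psi k $ p * bil (D p) (Psi i) (Psi j))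
        + bil g (H k i) (Psi j) + bil g (Psi i) (H k j)"
    and \<Phi>: "\<And>e. (\<Sum>a\<in>UNIV. \<Phi> a e *\<^sub>R Psi a) = axis e 1"
  shows "\<Gamma>' a k i = (\<Sum>e\<in>UNIV. \<Phi> a e * (H k i $ e
    + (\<Sum>p\<in>UNIV. \<Sum>q\<in>UNIV. Psi k $ p * (\<Gamma> e p q * Psi i $ q))))"
proof -
  define C where "C p u = (\<chi> m. \<Sum>q\<in>UNIV. \<Gamma> m p q * u $ q)" for p and u :: "real^'n"
  define T where "T k i = H k i + (\<Sum>p\<in>UNIV. Psi k $ p *\<^sub>R C p (Psi i))" for k i
  define \<Gamma>'' where "\<Gamma>'' a k i = (\<Sum>e\<in>UNIV. \<Phi> a e * T k i $ e)" for a k i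
  have T_nth: "T k i $ e = H k i $ e + (\<Sum>p\<in>UNIV. \<Sum>q\<in>UNIV. Psi k $ p * (\<Gamma> e p q * Psi i $ q))" for k i e
    by (simp add: T_def C_def sum_distrib_left)
  have T_sym: "T k i = T i k" for k i
  proof -
    have "(\<Sum>p\<in>UNIV. \<Sum>q\<in>UNIV. Psi k $ p * (\<Gamma> e p q * Psi i $ q))
        = (\<Sum>p\<in>UNIV. \<Sum>q\<in>UNIV. Psi i $ p * (\<Gamma> e p q * Psi k $ q))" for e
      by (rule trans[OF sum.swap]) (simp add: \<Gamma>_sym[of e] mult_ac)
    then show ?thesis by (simp add: vec_eq_iff T_nth H_sym[of k i])
  qed
  have lower_T: "(\<Sum>a\<in>UNIV. \<Gamma>'' a k i * g' a j) = bil g (T k i) (Psi j)" for k i j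
  proof -
    have "(\<Sum>a\<in>UNIV. \<Gamma>'' a k i *\<^sub>R Psi a) = (\<Sum>e\<in>UNIV. T k i $ e *\<^sub>R (\<Sum>a\<in>UNIV. \<Phi> a e *\<^sub>R Psi a))"
      unfolding \<Gamma>''_def scaleR_sum_left scaleR_sum_right
      by (rule trans[OF sum.swap]) (simp add: mult.commute)
    also have "\<dots> = T k i"
      unfolding \<Phi> using basis_expansion[of "T k i"] by (simp add: scalar_mult_eq_scaleR)
    finally have "bil g (\<Sum>a\<in>UNIV. \<Gamma>'' a k i *\<^sub>R Psi a) (Psi j) = bil g (T k i) (Psi j)" by simp
    then show ?thesis
      by (simp add: linear_sum[OF linear_bil_left] linear_cmul[OF linear_bil_left] g'_eq)
  qed
  have bil_D: "bil (D p) u v = bil g (C p u) v + bil g (C p v) u" for p u v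
  proof -
    have 1: "bil (\<lambda>i j. \<Sum>a\<in>UNIV. \<Gamma> a p i * g a j) u v = bil g (C p u) v" for u v
    proof -
      have "bil (\<lambda>i j. \<Sum>a\<in>UNIV. \<Gamma> a p i * g a j) u v
          = (\<Sum>i\<in>UNIV. \<Sum>a\<in>UNIV. \<Sum>j\<in>UNIV. g a j * (\<Gamma> a p i * u $ i) * v $ j)"
        unfolding bil_def
        by (rule sum.cong[OF refl], rule trans[OF _ sum.swap], simp only: sum_distrib_right) (simp only: mult_ac)
      also have "\<dots> = (\<Sum>a\<in>UNIV. \<Sum>j\<in>UNIV. \<Sum>i\<in>UNIV. g a j * (\<Gamma> a p i * u $ i) * v $ j)"
        by (rule trans[OF sum.swap], rule sum.cong[OF refl], rule sum.swap)
      finally show ?thesis by (simp add: bil_def C_def sum_distrib_left sum_distrib_right)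
    qed
    have "bil (D p) u v = bil (\<lambda>i j. \<Sum>a\<in>UNIV. \<Gamma> a p i * g a j) u v
        + bil (\<lambda>i j. \<Sum>a\<in>UNIV. \<Gamma> a p j * g a i) u v"
      by (simp add: bil_def compat sum.distrib distrib_right)
    also have "bil (\<lambda>i j. \<Sum>a\<in>UNIV. \<Gamma> a p j * g a i) u v = bil (\<lambda>i j. \<Sum>a\<in>UNIV. \<Gamma> a p i * g a j) v u"
      unfolding bil_def by (rule trans[OF sum.swap]) (simp add: mult_ac)
    finally show ?thesis by (simp add: 1)
  qed
  have bil_T: "bil g (T k i) v = bil g (H k i) v + (\<Sum>p\<in>UNIV. Psi k $ p * bil g (C p (Psi i)) v)" for k i v
    by (simp add: T_def linear_add[OF linear_bil_left] linear_sum[OF linear_bil_left]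
        linear_cmul[OF linear_bil_left])
  have "\<Gamma>' a k i = \<Gamma>'' a k i"
  proof (rule levi_civita_unique[where D = D', OF g'])
    show "\<Gamma>'' a i j = \<Gamma>'' a j i" for a i j by (simp add: \<Gamma>''_def T_sym[of i j])
    show "D' k i j = (\<Sum>a\<in>UNIV. \<Gamma>'' a k i * g' a j) + (\<Sum>a\<in>UNIV. \<Gamma>'' a k j * g' a i)" for k i j
      unfolding lower_T D'_eq bil_T bil_D
      by (simp add: bil_commute[OF g, of "Psi i" "H k j"] sum.distrib distrib_left)
  qed (use \<Gamma>'_sym compat' in auto)
  then show ?thesis by (simp add: \<Gamma>''_def T_nth)
qed


section \<open>Charts and tangent vectors\<close>

locale manifold =
  fixes X :: "'a topology" and \<A> :: "('a, 'n::finite) chart set"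
  assumes manifold: "smooth_manifold X \<A>"
begin

text \<open>The differential of a change of charts, indexed by the point instead of its coordinates: in this
  form the chain rule is a cocycle identity.\<close>

definition Dt :: "('a, 'n) chart \<Rightarrow> ('a, 'n) chart \<Rightarrow> 'a \<Rightarrow> real^'n \<Rightarrow> real^'n" where
  "Dt c d p = frechet_derivative (transition c d) (at (snd c p))"

context
  fixes c assumes c: "c \<in> \<A>"
begin

lemma is_chart: "is_chart X c" using manifold c by (auto simp: smooth_manifold_def)

lemma open_range: "open (snd c ` fst c)" using is_chart by (simp add: is_chart_def)

lemma openin_domain: "openin X (fst c)" using is_chart by (simp add: is_chart_def)

lemma domain_subset: "fst c \<subseteq> topspace X" using openin_domain openin_subset by blast

lemma chart_homeomorphic:
  "homeomorphic_map (subtopology X (fst c)) (top_of_set (snd c ` fst c)) (snd c)"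
  using is_chart by (simp add: is_chart_def)

lemma chart_inj: "inj_on (snd c) (fst c)"
  using homeomorphic_imp_injective_map[OF chart_homeomorphic] domain_subset
  by (simp add: Int_absorb1)

lemma chart_inv_chart [simp]: "p \<in> fst c \<Longrightarrow> chart_inv c (snd c p) = p"
  by (simp add: chart_inv_def chart_inj)

lemma open_chart_image:
  assumes "openin X W" "W \<subseteq> fst c" shows "open (snd c ` W)"
proof -
  have "openin (subtopology X (fst c)) W" using assms by (auto simp: openin_subtopology)
  then have "openin (top_of_set (snd c ` fst c)) (snd c ` W)"
    using homeomorphic_imp_open_map[OF chart_homeomorphic] by (simp add: open_map_def)
  then show ?thesis using open_range openin_open_trans by blast
qed

lemma transition_chart [simp]: "p \<in> fst c \<Longrightarrow> transition c d (snd c p) = snd d p"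
  by (simp add: transition_def)

end

lemma open_overlap: "c \<in> \<A> \<Longrightarrow> d \<in> \<A> \<Longrightarrow> open (snd c ` (fst c \<inter> fst d))"
  by (rule open_chart_image[OF _ openin_Int[OF openin_domain openin_domain]]) simp_all

lemma transition_smooth: "c \<in> \<A> \<Longrightarrow> d \<in> \<A> \<Longrightarrow> smooth_on (snd c ` (fst c \<inter> fst d)) (transition c d)"
  using manifold by (auto simp: smooth_manifold_def compatible_def)

lemma transition_nth_smooth:
  "c \<in> \<A> \<Longrightarrow> d \<in> \<A> \<Longrightarrow> smooth_on (snd c ` (fst c \<inter> fst d)) (\<lambda>x. transition c d x $ k)"
  by (rule smooth_on_bounded_linear_compose[OF open_overlap bounded_linear_vec_nth transition_smooth])

lemma transition_has_derivative:
  "c \<in> \<A> \<Longrightarrow> d \<in> \<A> \<Longrightarrow> p \<in> fst c \<Longrightarrow> p \<in> fst d \<Longrightarrow>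
    (transition c d has_derivative Dt c d p) (at (snd c p))"
  unfolding Dt_def by (rule smooth_on_has_derivative[OF transition_smooth]) auto

lemma Dt_linear: "c \<in> \<A> \<Longrightarrow> d \<in> \<A> \<Longrightarrow> p \<in> fst c \<Longrightarrow> p \<in> fst d \<Longrightarrow> linear (Dt c d p)"
  by (rule has_derivative_linear[OF transition_has_derivative])

lemma Dt_cocycle:
  assumes "c \<in> \<A>" "d \<in> \<A>" "e \<in> \<A>" "p \<in> fst c" "p \<in> fst d" "p \<in> fst e"
  shows "Dt d e p (Dt c d p v) = Dt c e p v"
proof -
  have "((\<lambda>x. transition d e (transition c d x)) has_derivative (\<lambda>v. Dt d e p (Dt c d p v))) (at (snd c p))"
  proof (rule has_derivative_compose[OF transition_has_derivative])
    show "(transition d e has_derivative Dt d e p) (at (transition c d (snd c p)))"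
      using transition_has_derivative[of d e p] assms by simp
  qed (use assms in simp_all)
  then have d: "(transition c e has_derivative (\<lambda>v. Dt d e p (Dt c d p v))) (at (snd c p))"
  proof (rule has_derivative_transform_within_open)
    show "open (snd c ` (fst c \<inter> fst d \<inter> fst e))"
      by (rule open_chart_image[OF assms(1)]) (use assms(1-3) in \<open>auto intro!: openin_Int openin_domain\<close>)
  qed (use assms in auto)
  have "(\<lambda>v. Dt d e p (Dt c d p v)) = Dt c e p"
    by (rule has_derivative_unique[OF d transition_has_derivative]) (use assms in simp_all)
  then show ?thesis by (rule fun_cong)
qed

lemma Dt_self:
  assumes "c \<in> \<A>" "p \<in> fst c" shows "Dt c c p v = v"
proof -
  have d: "(transition c c has_derivative (\<lambda>v. v)) (at (snd c p))"
    by (rule has_derivative_transform_within_open[OF has_derivative_ident open_range[OF assms(1)]])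
      (use assms in auto)
  have "(\<lambda>v. v) = Dt c c p"
    by (rule has_derivative_unique[OF d transition_has_derivative]) (use assms in simp_all)
  then show ?thesis by metis
qed

lemma Dt_inverse:
  "c \<in> \<A> \<Longrightarrow> d \<in> \<A> \<Longrightarrow> p \<in> fst c \<Longrightarrow> p \<in> fst d \<Longrightarrow> Dt d c p (Dt c d p v) = v"
  by (simp add: Dt_cocycle Dt_self)

lemma jac_eq:
  assumes "c \<in> \<A>" "d \<in> \<A>" "p \<in> fst c" "p \<in> fst d"
  shows "jac c d k a (snd c p) = Dt c d p (axis a 1) $ k"
  unfolding jac_def
  by (rule pd_eqI[OF bounded_linear.has_derivative[OF bounded_linear_vec_nth
        transition_has_derivative[OF assms]]]) simp

lemma Dt_nth:
  assumes "c \<in> \<A>" "d \<in> \<A>" "p \<in> fst c" "p \<in> fst d"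
  shows "Dt c d p v $ k = (\<Sum>a\<in>UNIV. jac c d k a (snd c p) * v $ a)"
  using arg_cong[OF linear_eq_sum_axis[OF Dt_linear[OF assms], of v], of "\<lambda>w. w $ k"]
  by (simp add: jac_eq[OF assms] mult.commute)

lemma jac_smooth: "c \<in> \<A> \<Longrightarrow> d \<in> \<A> \<Longrightarrow> smooth_on (snd c ` (fst c \<inter> fst d)) (jac c d k a)"
  unfolding jac_def by (rule smooth_on_pd[OF transition_nth_smooth])

lemma hess_eq: "hess c d k a b = pd a (jac c d k b)"
  by (simp add: hess_def jac_def)

lemma hess_commute:
  assumes "c \<in> \<A>" "d \<in> \<A>" "x \<in> snd c ` (fst c \<inter> fst d)"
  shows "hess c d k a b x = hess c d k b a x"
  unfolding hess_def pd_def[abs_def]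
  by (rule second_derivative_symmetric[OF open_overlap assms(3) transition_nth_smooth]) (use assms in auto)

lemma tvec_of_eq: "d \<in> \<A> \<Longrightarrow> p \<in> fst d \<Longrightarrow> tvec_of \<A> c p y d = Dt c d p y"
  by (simp add: tvec_of_def Dt_def)

lemma tvec_of_linear:
  assumes "c \<in> \<A>" "p \<in> fst c"
  shows "tvec_of \<A> c p (a *\<^sub>R y + b *\<^sub>R z) = tadd (tscale a (tvec_of \<A> c p y)) (tscale b (tvec_of \<A> c p z))"
proof
  fix d
  show "tvec_of \<A> c p (a *\<^sub>R y + b *\<^sub>R z) d = tadd (tscale a (tvec_of \<A> c p y)) (tscale b (tvec_of \<A> c p z)) d"
  proof (cases "d \<in> \<A> \<and> p \<in> fst d")
    case True
    then have "linear (Dt c d p)" using assms Dt_linear by blast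
    then show ?thesis using True by (simp add: tadd_def tscale_def tvec_of_eq linear_add linear_cmul)
  qed (auto simp: tadd_def tscale_def tvec_of_def)
qed

lemma tvec_of_in_tangent_space:
  assumes "c \<in> \<A>" "p \<in> fst c"
  shows "tvec_of \<A> c p y \<in> tangent_space \<A> p"
proof -
  have "tvec_of \<A> c p y e = frechet_derivative (transition d e) (at (snd d p)) (tvec_of \<A> c p y d)"
    if "d \<in> \<A>" "e \<in> \<A>" "p \<in> fst d \<inter> fst e" for d e
    using Dt_cocycle[of c d e p y] that assms by (simp add: tvec_of_eq flip: Dt_def)
  moreover have "tvec_of \<A> c p y d = 0" if "d \<notin> \<A> \<or> p \<notin> fst d" for d
    using that by (auto simp: tvec_of_def)
  ultimately show ?thesis unfolding tangent_space_def by blast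
qed

lemma tvec_of_nonzero:
  assumes "c \<in> \<A>" "p \<in> fst c" "y \<noteq> 0"
  shows "tvec_of \<A> c p y \<noteq> (\<lambda>_. 0)"
  using assms tvec_of_eq[of c p c y] Dt_self[of c p y] by auto

lemma tvec_of_change:
  assumes "c \<in> \<A>" "d \<in> \<A>" "p \<in> fst c" "p \<in> fst d"
  shows "tvec_of \<A> d p (Dt c d p y) = tvec_of \<A> c p y"
proof
  fix e
  show "tvec_of \<A> d p (Dt c d p y) e = tvec_of \<A> c p y e"
  proof (cases "e \<in> \<A> \<and> p \<in> fst e")
    case True
    then show ?thesis using Dt_cocycle[of c d e p y] assms by (simp add: tvec_of_eq)
  qed (auto simp: tvec_of_def)
qed

lemma zero_in_tangent_space:
  assumes "p \<in> topspace X" shows "(\<lambda>_. 0) \<in> tangent_space \<A> p"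
proof -
  have "frechet_derivative (transition c d) (at (snd c p)) 0 = 0"
    if "c \<in> \<A>" "d \<in> \<A>" "p \<in> fst c \<inter> fst d" for c d
    using linear_0[OF Dt_linear[of c d p]] that by (simp add: Dt_def)
  then show ?thesis by (simp add: tangent_space_def)
qed

end

section \<open>Riemannian manifolds\<close>

locale riemannian_manifold = manifold X \<A>
  for X :: "'a topology" and \<A> :: "('a, 'n::finite) chart set" +
  fixes gR :: "'a \<Rightarrow> ('a, 'n) tvec \<Rightarrow> ('a, 'n) tvec \<Rightarrow> real"
    and L :: "'a \<times> ('a, 'n) tvec \<Rightarrow> real"
  assumes metric: "riemannian_metric X \<A> gR"
    and L_eq: "\<And>p v. (p, v) \<in> slit_TM X \<A> \<Longrightarrow> L (p, v) = gR p v v"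
begin

definition G :: "('a, 'n) chart \<Rightarrow> 'n \<Rightarrow> 'n \<Rightarrow> real^'n \<Rightarrow> real" where
  "G c a b x = gR (chart_inv c x) (coord_vec \<A> c (chart_inv c x) a) (coord_vec \<A> c (chart_inv c x) b)"

lemma gR_tvec_of:
  assumes c: "c \<in> \<A>" and p: "p \<in> fst c"
  shows "gR p (tvec_of \<A> c p y) (tvec_of \<A> c p z) = bil (\<lambda>a b. G c a b (snd c p)) y z"
proof -
  define B where "B y z = gR p (tvec_of \<A> c p y) (tvec_of \<A> c p z)" for y z
  have X: "p \<in> topspace X" using domain_subset[OF c] p by blast
  note T = tvec_of_in_tangent_space[OF c p]
  have B_comm: "B y z = B z y" for y z
    using metric X T unfolding riemannian_metric_def B_def by blast
  have B_lin: "B (a *\<^sub>R y + b *\<^sub>R y') z = a * B y z + b * B y' z" for a b y y' z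
    using metric X T unfolding riemannian_metric_def B_def tvec_of_linear[OF c p] by blast
  have left: "linear (\<lambda>y. B y z)" for z
  proof (rule linearI)
    show "B (y + y') z = B y z + B y' z" for y y' using B_lin[of 1 y 1 y' z] by simp
    show "B (a *\<^sub>R y) z = a *\<^sub>R B y z" for a y using B_lin[of a y 0 y z] by simp
  qed
  then have right: "linear (B y)" for y using B_comm by presburger
  have expand: "B v z = (\<Sum>b\<in>UNIV. z $ b * B v (axis b 1))" for v
    using linear_eq_sum_axis[OF right, of v z] by simp
  have "B y z = (\<Sum>a\<in>UNIV. y $ a * B (axis a 1) z)"
    using linear_eq_sum_axis[OF left, of y z] by simp
  also have "\<dots> = (\<Sum>a\<in>UNIV. y $ a * (\<Sum>b\<in>UNIV. z $ b * B (axis a 1) (axis b 1)))"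
    by (intro sum.cong refl) (simp only: expand[symmetric])
  also have "\<dots> = bil (\<lambda>a b. B (axis a 1) (axis b 1)) y z"
    by (simp add: bil_def sum_distrib_left mult_ac)
  also have "(\<lambda>a b. B (axis a 1) (axis b 1)) = (\<lambda>a b. G c a b (snd c p))"
    by (simp add: B_def G_def coord_vec_def c p)
  finally show ?thesis by (simp add: B_def)
qed

lemma G_transformation:
  assumes c: "c \<in> \<A>" "p \<in> fst c" and d: "d \<in> \<A>" "p \<in> fst d"
  shows "G d i j (snd d p) = bil (\<lambda>a b. G c a b (snd c p)) (Dt d c p (axis i 1)) (Dt d c p (axis j 1))"
proof -
  have "G d i j (snd d p) = gR p (tvec_of \<A> d p (axis i 1)) (tvec_of \<A> d p (axis j 1))"
    by (simp add: G_def coord_vec_def d)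
  also have "\<dots> = gR p (tvec_of \<A> c p (Dt d c p (axis i 1))) (tvec_of \<A> c p (Dt d c p (axis j 1)))"
    by (simp add: tvec_of_change c d)
  finally show ?thesis by (simp add: gR_tvec_of c)
qed

lemma coordinates:
  assumes c: "c \<in> \<A>"
  shows "riemannian_coordinates (snd c ` fst c) (G c) (local_rep \<A> L c)"
proof
  show "open (snd c ` fst c)" by (rule open_range[OF c])
  show "smooth_on (snd c ` fst c) (G c a b)" for a b
    using metric c unfolding riemannian_metric_def G_def[abs_def] by blast
  fix x assume "x \<in> snd c ` fst c"
  then obtain p where p: "p \<in> fst c" and x: "x = snd c p" by blast
  have X: "p \<in> topspace X" using domain_subset[OF c] p by blast
  note T = tvec_of_in_tangent_space[OF c p]
  show "scalar_product (\<lambda>a b. G c a b x)"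
    unfolding scalar_product_def
  proof (intro conjI allI impI)
    show "G c a b x = G c b a x" for a b
      using metric X T unfolding riemannian_metric_def by (simp add: x G_def coord_vec_def c p)
    show "bil (\<lambda>a b. G c a b x) v v > 0" if "v \<noteq> 0" for v
      unfolding x gR_tvec_of[OF c p, symmetric]
      using metric X T tvec_of_nonzero[OF c p that] unfolding riemannian_metric_def by blast
  qed
  show "local_rep \<A> L c x y = bil (\<lambda>a b. G c a b x) y y" if "y \<noteq> 0" for y
  proof -
    have "(p, tvec_of \<A> c p y) \<in> slit_TM X \<A>"
      using X T tvec_of_nonzero[OF c p that] by (simp add: slit_TM_def)
    then show ?thesis by (simp add: x local_rep_def TM_point_def c p L_eq gR_tvec_of)
  qed
qed

abbreviation \<Gamma> :: "('a, 'n) chart \<Rightarrow> 'n \<Rightarrow> 'n \<Rightarrow> 'n \<Rightarrow> real^'n \<Rightarrow> real" where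
  "\<Gamma> c \<equiv> riemannian_coordinates.chris (G c)"

text \<open>Product and chain rule for \<open>g'\<^sub>i\<^sub>j(z) = g\<^sub>a\<^sub>b(\<psi>(z)) \<partial>\<^sub>i\<psi>\<^sup>a \<partial>\<^sub>j\<psi>\<^sup>b\<close>, where \<open>\<psi>\<close> is the change from the
  chart \<open>d\<close> to the chart \<open>c\<close>.\<close>

lemma pd_G_transformation:
  assumes c: "c \<in> \<A>" "p \<in> fst c" and d: "d \<in> \<A>" "p \<in> fst d"
  defines "x \<equiv> snd c p" and "z \<equiv> snd d p"
  defines "Psi \<equiv> \<lambda>i. Dt d c p (axis i 1)" and "H \<equiv> \<lambda>i j. \<chi> e. hess d c e i j z"
  shows "pd k (G d i j) z = (\<Sum>m\<in>UNIV. Psi k $ m * bil (\<lambda>a b. pd m (G c a b) x) (Psi i) (Psi j))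
    + bil (\<lambda>a b. G c a b x) (H k i) (Psi j) + bil (\<lambda>a b. G c a b x) (Psi i) (H k j)"
proof -
  let ?V = "snd d ` (fst d \<inter> fst c)" and ?\<psi> = "transition d c"
  have V: "open ?V" "z \<in> ?V" using open_overlap[OF d(1) c(1)] c d by (auto simp: z_def)
  have \<psi>z: "?\<psi> z = x" by (simp add: z_def x_def d)
  interpret c: riemannian_coordinates "snd c ` fst c" "G c" "local_rep \<A> L c"
    by (rule coordinates[OF c(1)])
  have "pd k (G d i j) z = pd k (\<lambda>z. \<Sum>a\<in>UNIV. \<Sum>b\<in>UNIV. G c a b (?\<psi> z) * jac d c a i z * jac d c b j z) z"
  proof (rule pd_cong[OF V])
    fix z' assume "z' \<in> ?V"
    then obtain q where q: "q \<in> fst d" "q \<in> fst c" and z': "z' = snd d q" by blast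
    show "G d i j z' = (\<Sum>a\<in>UNIV. \<Sum>b\<in>UNIV. G c a b (?\<psi> z') * jac d c a i z' * jac d c b j z')"
      unfolding z' by (simp add: G_transformation[OF c(1) q(2) d(1) q(1)] bil_def q jac_eq c d)
  qed
  also have "\<dots> = (\<Sum>a\<in>UNIV. \<Sum>b\<in>UNIV. G c a b x * jac d c a i z * hess d c b k j z
      + (G c a b x * hess d c a k i z + (\<Sum>m\<in>UNIV. Psi k $ m * pd m (G c a b) x) * jac d c a i z) * jac d c b j z)"
  proof -
    have jd: "jac d c a i differentiable at z" for a i
      by (rule smooth_on_differentiable[OF jac_smooth V(2)]) (use c d in auto)
    have "((\<lambda>z. G c a b (?\<psi> z)) has_derivative (\<lambda>v. \<Sum>m\<in>UNIV. Dt d c p v $ m * pd m (G c a b) x)) (at z)" for a b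
    proof -
      have "G c a b differentiable at (?\<psi> z)"
        unfolding \<psi>z by (rule smooth_on_differentiable[OF c.G_smooth]) (use c in \<open>auto simp: x_def\<close>)
      from has_derivative_compose[OF transition_has_derivative[OF d(1) c(1) d(2) c(2), folded z_def]
          has_derivative_pd[OF this]]
      show ?thesis by (simp add: \<psi>z)
    qed
    then have Gd: "(\<lambda>z. G c a b (?\<psi> z)) differentiable at z"
      and Gpd: "pd k (\<lambda>z. G c a b (?\<psi> z)) z = (\<Sum>m\<in>UNIV. Psi k $ m * pd m (G c a b) x)" for a b
      unfolding Psi_def by (auto simp: differentiable_def intro: pd_eqI)
    show ?thesis
      by (simp add: pd_sum pd_mult Gd jd Gpd hess_eq \<psi>z)
  qed
  also have "\<dots> = (\<Sum>a\<in>UNIV. \<Sum>b\<in>UNIV. (\<Sum>m\<in>UNIV. Psi k $ m * pd m (G c a b) x) * Psi i $ a * Psi j $ b)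
      + bil (\<lambda>a b. G c a b x) (H k i) (Psi j) + bil (\<lambda>a b. G c a b x) (Psi i) (H k j)"
    by (simp add: bil_def H_def Psi_def z_def jac_eq c d sum.distrib algebra_simps)
  also have "(\<Sum>a\<in>UNIV. \<Sum>b\<in>UNIV. (\<Sum>m\<in>UNIV. Psi k $ m * pd m (G c a b) x) * Psi i $ a * Psi j $ b)
      = (\<Sum>m\<in>UNIV. Psi k $ m * bil (\<lambda>a b. pd m (G c a b) x) (Psi i) (Psi j))"
  proof -
    have "(\<Sum>m\<in>UNIV. Psi k $ m * bil (\<lambda>a b. pd m (G c a b) x) (Psi i) (Psi j))
      = (\<Sum>m\<in>UNIV. \<Sum>a\<in>UNIV. \<Sum>b\<in>UNIV. Psi k $ m * pd m (G c a b) x * Psi i $ a * Psi j $ b)"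
      by (simp add: bil_def sum_distrib_left mult_ac)
    also have "\<dots> = (\<Sum>a\<in>UNIV. \<Sum>b\<in>UNIV. \<Sum>m\<in>UNIV. Psi k $ m * pd m (G c a b) x * Psi i $ a * Psi j $ b)"
      by (rule trans[OF sum.swap], rule sum.cong[OF refl], rule sum.swap)
    finally show ?thesis by (simp add: sum_distrib_right)
  qed
  finally show ?thesis .
qed

lemma \<Gamma>_transformation:
  assumes c: "c \<in> \<A>" "p \<in> fst c" and d: "d \<in> \<A>" "p \<in> fst d"
  defines "x \<equiv> snd c p" and "z \<equiv> snd d p"
  shows "\<Gamma> d k i j z = (\<Sum>e\<in>UNIV. jac c d k e x * (hess d c e i j z
    + (\<Sum>a\<in>UNIV. \<Sum>b\<in>UNIV. jac d c a i z * (\<Gamma> c e a b x * jac d c b j z))))"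
proof -
  interpret c: riemannian_coordinates "snd c ` fst c" "G c" "local_rep \<A> L c"
    by (rule coordinates[OF c(1)])
  interpret d: riemannian_coordinates "snd d ` fst d" "G d" "local_rep \<A> L d"
    by (rule coordinates[OF d(1)])
  have x: "x \<in> snd c ` fst c" and z: "z \<in> snd d ` fst d" "z \<in> snd d ` (fst d \<inter> fst c)"
    using c d by (auto simp: x_def z_def)
  let ?Psi = "\<lambda>i. Dt d c p (axis i 1)" and ?H = "\<lambda>i j. \<chi> e. hess d c e i j z"
  have "\<Gamma> d k i j z = (\<Sum>e\<in>UNIV. jac c d k e x * (?H i j $ e
    + (\<Sum>a\<in>UNIV. \<Sum>b\<in>UNIV. ?Psi i $ a * (\<Gamma> c e a b x * ?Psi j $ b))))"
  proof (rule christoffel_transformation[where g = "\<lambda>a b. G c a b x" and g' = "\<lambda>a b. G d a b z"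
        and D = "\<lambda>k i j. pd k (G c i j) x" and D' = "\<lambda>k i j. pd k (G d i j) z"
        and \<Phi> = "\<lambda>k e. jac c d k e x" and \<Gamma> = "\<lambda>k i j. \<Gamma> c k i j x" and \<Gamma>' = "\<lambda>k i j. \<Gamma> d k i j z"
        and Psi = ?Psi and H = ?H])
    show "?H i j = ?H j i" for i j
      using hess_commute[OF d(1) c(1) z(2)] by (simp add: vec_eq_iff)
    show "G d i j z = bil (\<lambda>a b. G c a b x) (?Psi i) (?Psi j)" for i j
      unfolding x_def z_def by (rule G_transformation[OF c d])
    show "pd k (G d i j) z = (\<Sum>m\<in>UNIV. ?Psi k $ m * bil (\<lambda>i j. pd m (G c i j) x) (?Psi i) (?Psi j))
        + bil (\<lambda>a b. G c a b x) (?H k i) (?Psi j) + bil (\<lambda>a b. G c a b x) (?Psi i) (?H k j)" for k i j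
      unfolding x_def z_def by (rule pd_G_transformation[OF c d])
    show "(\<Sum>a\<in>UNIV. jac c d a e x *\<^sub>R ?Psi a) = axis e 1" for e
    proof -
      have "Dt d c p (Dt c d p (axis e 1)) = (\<Sum>a\<in>UNIV. Dt c d p (axis e 1) $ a *\<^sub>R ?Psi a)"
        by (rule linear_eq_sum_axis[OF Dt_linear]) (use c d in auto)
      then show ?thesis by (simp add: Dt_inverse c d x_def jac_eq)
    qed
  qed (use x z in \<open>auto intro: c.G_scalar_product d.G_scalar_product c.chris_commute d.chris_commute
        c.chris_compatible d.chris_compatible\<close>)
  then show ?thesis by (simp add: z_def jac_eq c d)
qed

lemma metric_connection_eq:
  "c \<in> \<A> \<Longrightarrow> x \<in> snd c ` fst c \<Longrightarrow> y \<noteq> 0 \<Longrightarrow>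
    metric_connection \<A> L c k i x y = (\<Sum>a\<in>UNIV. \<Gamma> c k i a x * y $ a)"
  using riemannian_coordinates.NL_eq[OF coordinates] by (simp add: metric_connection_def)

text \<open>Contraction of the transformation law of the Christoffel symbols with the transformed vector
  \<open>w\<close>; the Jacobian of the inverse change of charts maps \<open>w\<close> back to \<open>y\<close>.\<close>

lemma metric_connection_transformation:
  assumes c: "c \<in> \<A>" "p \<in> fst c" and d: "d \<in> \<A>" "p \<in> fst d" and y: "y \<noteq> 0"
  defines "x \<equiv> snd c p" and "z \<equiv> snd d p" and "w \<equiv> (\<chi> b. \<Sum>a\<in>UNIV. jac c d b a (snd c p) * y $ a)"
  shows "metric_connection \<A> L d k i z w =
    (\<Sum>e\<in>UNIV. \<Sum>b\<in>UNIV. jac c d k e x * hess d c e i b z * w $ b) +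
    (\<Sum>e\<in>UNIV. \<Sum>a\<in>UNIV. jac c d k e x * jac d c a i z * metric_connection \<A> L c e a x y)"
proof -
  have w: "w = Dt c d p y"
    using c d by (simp add: w_def vec_eq_iff Dt_nth)
  have y_eq: "(\<Sum>b\<in>UNIV. jac d c q b z * w $ b) = y $ q" for q
    using Dt_nth[OF d(1) c(1) d(2) c(2), of w q] Dt_inverse[OF c(1) d(1) c(2) d(2), of y]
    by (simp add: w z_def)
  have w0: "w \<noteq> 0"
    using y Dt_inverse[OF c(1) d(1) c(2) d(2), of y] linear_0[OF Dt_linear[OF d(1) c(1) d(2) c(2)]]
    by (auto simp: w)
  have "metric_connection \<A> L d k i z w = (\<Sum>b\<in>UNIV. \<Gamma> d k i b z * w $ b)"
    by (rule metric_connection_eq) (use d w0 in \<open>auto simp: z_def\<close>)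
  also have "\<dots> = (\<Sum>b\<in>UNIV. \<Sum>e\<in>UNIV. jac c d k e x * hess d c e i b z * w $ b
      + (\<Sum>a\<in>UNIV. \<Sum>q\<in>UNIV. jac c d k e x * jac d c a i z * (\<Gamma> c e a q x * (jac d c q b z * w $ b))))"
    unfolding x_def z_def \<Gamma>_transformation[OF c d]
    by (simp add: sum_distrib_left sum_distrib_right distrib_left distrib_right mult_ac)
  also have "\<dots> = (\<Sum>e\<in>UNIV. \<Sum>b\<in>UNIV. jac c d k e x * hess d c e i b z * w $ b)
    + (\<Sum>e\<in>UNIV. \<Sum>b\<in>UNIV. \<Sum>a\<in>UNIV. \<Sum>q\<in>UNIV.
        jac c d k e x * jac d c a i z * (\<Gamma> c e a q x * (jac d c q b z * w $ b)))"
    by (rule trans[OF sum.swap]) (simp add: sum.distrib)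
  also have "(\<Sum>e\<in>UNIV. \<Sum>b\<in>UNIV. \<Sum>a\<in>UNIV. \<Sum>q\<in>UNIV.
        jac c d k e x * jac d c a i z * (\<Gamma> c e a q x * (jac d c q b z * w $ b)))
      = (\<Sum>e\<in>UNIV. \<Sum>a\<in>UNIV. \<Sum>q\<in>UNIV. \<Sum>b\<in>UNIV.
        jac c d k e x * jac d c a i z * (\<Gamma> c e a q x * (jac d c q b z * w $ b)))"
    by (rule sum.cong[OF refl], rule trans[OF sum.swap], rule sum.cong[OF refl], rule sum.swap)
  also have "\<dots> = (\<Sum>e\<in>UNIV. \<Sum>a\<in>UNIV. jac c d k e x * jac d c a i z * (\<Sum>q\<in>UNIV. \<Gamma> c e a q x * y $ q))"
    by (simp only: sum_distrib_left[symmetric] y_eq)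
  also have "\<dots> = (\<Sum>e\<in>UNIV. \<Sum>a\<in>UNIV. jac c d k e x * jac d c a i z * metric_connection \<A> L c e a x y)"
    by (simp add: metric_connection_eq c y x_def)
  finally show ?thesis .
qed

lemma open_slit_coords: "c \<in> \<A> \<Longrightarrow> open (slit_coords c)"
  unfolding slit_coords_def by (intro open_Times open_range) (simp_all add: open_Compl)

lemma metric_connection_is_connection: "homog_nonlinear_connection \<A> (metric_connection \<A> L)"
  unfolding homog_nonlinear_connection_def Let_def
proof (intro conjI ballI allI impI)
  fix c k i assume c: "c \<in> \<A>"
  show "smooth_cfun c (metric_connection \<A> L c k i)"
    using riemannian_coordinates.NL_smooth[OF coordinates[OF c]]
    by (simp add: smooth_cfun_def slit_coords_def metric_connection_def)
  show "homog_cfun 1 c (metric_connection \<A> L c k i)"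
    using riemannian_coordinates.NL_homog[OF coordinates[OF c]]
    by (auto simp: homog_cfun_def slit_coords_def metric_connection_def)
qed (use metric_connection_transformation in auto)

lemma metric_connection_symmetric: "symmetric_connection \<A> (metric_connection \<A> L)"
  unfolding symmetric_connection_def
proof (intro ballI allI, clarify)
  fix c x y k i j assume c: "c \<in> \<A>" and "(x, y) \<in> slit_coords c"
  then have xy: "x \<in> snd c ` fst c" "y \<noteq> 0" by (auto simp: slit_coords_def)
  interpret riemannian_coordinates "snd c ` fst c" "G c" "local_rep \<A> L c"
    by (rule coordinates[OF c])
  show "dy j (metric_connection \<A> L c k i) x y = dy i (metric_connection \<A> L c k j) x y"
    using chris_commute[OF xy(1)] by (simp add: metric_connection_def dy_NL xy)
qed

lemma metric_connection_solves: "solves_affine_equation X \<A> L (metric_connection \<A> L)"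
proof -
  define J :: "('a, 'n) atensor11" where "J = (\<lambda>_ _ _. 0)"
  have comp: "comp11 \<A> J c = (\<lambda>_ _ _ _. 0)" for c
    by (simp add: comp11_def fun_eq_iff J_def)
  have "homog_tensor11 1 X \<A> J"
    unfolding homog_tensor11_def anisotropic_tensor11_def comp
    by (auto simp: smooth_cfun_def homog_cfun_def case_prod_unfold J_def tadd_def tscale_def
        slit_TM_def open_slit_coords intro!: smooth_on_const zero_in_tangent_space)
  moreover have "affine_lhs (local_rep \<A> L c) (comp11 \<A> J c) i j x y = 0"
    if "c \<in> \<A>" "(x, y) \<in> slit_coords c" for c i j x y
    unfolding comp
    by (rule riemannian_coordinates.affine_lhs_zero[OF coordinates[OF that(1)]])
      (use that in \<open>auto simp: slit_coords_def\<close>)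
  ultimately show ?thesis
    unfolding solves_affine_equation_def
    using metric_connection_is_connection by (auto simp: comp intro!: exI[of _ J])
qed

lemma smooth_cfun_slice:
  fixes c :: "('a, 'n) chart"
  assumes "smooth_cfun c f" "x \<in> snd c ` fst c"
  shows "smooth_on (- {0}) (f x)"
proof -
  have "smooth_on (- {0}) (\<lambda>y. (\<lambda>(x, y). f x y) ((x, 0) + (0, y)))"
  proof (rule smooth_on_compose_affine[where S = "slit_coords c" and f = "\<lambda>(x, y). f x y"
        and z = "(x, 0)" and l = "\<lambda>y. (0, y)"])
    show "bounded_linear (\<lambda>y::real^'n. (0::real^'n, y))"
      by (intro bounded_linear_Pair bounded_linear_zero bounded_linear_ident)
  qed (use assms in \<open>auto simp: smooth_cfun_def slit_coords_def open_Compl\<close>)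
  then show ?thesis by simp
qed

lemma symmetric_solution_unique:
  assumes dim: "CARD('n) \<ge> 3" and N: "symmetric_connection \<A> N" "solves_affine_equation X \<A> L N"
    and c: "c \<in> \<A>" and xy: "(x, y) \<in> slit_coords c"
  shows "N c k i x y = metric_connection \<A> L c k i x y"
proof -
  interpret riemannian_coordinates "snd c ` fst c" "G c" "local_rep \<A> L c"
    by (rule coordinates[OF c])
  obtain J where J: "homog_tensor11 1 X \<A> J"
    and NJ: "\<And>x y k i. (x, y) \<in> slit_coords c \<Longrightarrow>
      N c k i x y = metric_connection \<A> L c k i x y + comp11 \<A> J c k i x y"
    and eq: "\<And>x y i j. (x, y) \<in> slit_coords c \<Longrightarrow>
      affine_lhs (local_rep \<A> L c) (comp11 \<A> J c) i j x y = 0"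
    using N(2) c unfolding solves_affine_equation_def by fast
  have x: "x \<in> snd c ` fst c" and y: "y \<noteq> 0" using xy by (auto simp: slit_coords_def)
  have slit: "(x, y) \<in> slit_coords c" if "y \<noteq> 0" for y using x that by (simp add: slit_coords_def)
  have J_smooth: "smooth_on (- {0}) (comp11 \<A> J c k i x)" for k i
    by (rule smooth_cfun_slice[OF _ x]) (use J c in \<open>auto simp: homog_tensor11_def anisotropic_tensor11_def\<close>)
  have M_smooth: "smooth_on (- {0}) (metric_connection \<A> L c k i x)" for k i
    by (rule smooth_cfun_slice[OF _ x])
      (use metric_connection_is_connection c in \<open>auto simp: homog_nonlinear_connection_def\<close>)
  have dy_N: "dy j (N c k i) x y = dy j (metric_connection \<A> L c k i) x y + dy j (comp11 \<A> J c k i) x y"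
    if "y \<noteq> 0" for j k i y
  proof -
    have "dy j (N c k i) x y = pd j (\<lambda>y. metric_connection \<A> L c k i x y + comp11 \<A> J c k i x y) y"
      unfolding dy_def by (rule pd_cong[OF open_slit]) (use that NJ slit in auto)
    also have "\<dots> = dy j (metric_connection \<A> L c k i) x y + dy j (comp11 \<A> J c k i) x y"
      unfolding dy_def using that
      by (intro pd_add smooth_on_differentiable[OF J_smooth] smooth_on_differentiable[OF M_smooth]) auto
    finally show ?thesis .
  qed
  have "comp11 \<A> J c k i x y = 0"
  proof (rule symmetric_solution_eq_0[where J = "comp11 \<A> J c" and x = x, OF dim x J_smooth _ _ _ y])
    fix y :: "real^'n" and k i j assume y: "y \<noteq> 0"
    have "homog_cfun 1 c (comp11 \<A> J c k i)" using J c by (simp add: homog_tensor11_def)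
    from bspec[OF this[unfolded homog_cfun_def] slit[OF y]]
    show "comp11 \<A> J c k i x (t *\<^sub>R y) = t * comp11 \<A> J c k i x y" if "t > 0" for t
      using that by simp
    have "dy j (M c k i) x y = dy i (M c k j) x y" if "symmetric_connection \<A> M" for M
      using bspec[OF bspec[OF that[unfolded symmetric_connection_def] c] slit[OF y]] by simp
    from this[OF N(1)] this[OF metric_connection_symmetric]
    show "dy j (comp11 \<A> J c k i) x y = dy i (comp11 \<A> J c k j) x y"
      by (simp add: dy_N[OF y])
    show "affine_lhs (local_rep \<A> L c) (comp11 \<A> J c) i j x y = 0"
      by (rule eq[OF slit[OF y]])
  qed
  then show ?thesis using NJ[OF xy] by simp
qed

end

theorem theorem5p17:
  fixes X :: "'a topology"
    and \<A> :: "('a, 'n::finite) chart set"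
    and gR :: "'a \<Rightarrow> ('a, 'n) tvec \<Rightarrow> ('a, 'n) tvec \<Rightarrow> real"
    and L :: "'a \<times> ('a, 'n) tvec \<Rightarrow> real"
  assumes "smooth_manifold X \<A>"
    and "connected_space X"
    and "CARD('n) \<ge> 3"
    and "riemannian_metric X \<A> gR"
    and "\<And>p v. (p, v) \<in> slit_TM X \<A> \<Longrightarrow> L (p, v) = gR p v v"
  shows "solves_affine_equation X \<A> L (metric_connection \<A> L) \<and>
    symmetric_connection \<A> (metric_connection \<A> L) \<and>
    (\<forall>N. homog_nonlinear_connection \<A> N \<and> symmetric_connection \<A> N \<and>
         solves_affine_equation X \<A> L N \<longrightarrow>
       (\<forall>c\<in>\<A>. \<forall>(x, y)\<in>slit_coords c. \<forall>k i.
          N c k i x y = metric_connection \<A> L c k i x y))"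
proof -
  interpret riemannian_manifold X \<A> gR L
    by unfold_locales (use assms in auto)
  show ?thesis
    using metric_connection_solves metric_connection_symmetric
      symmetric_solution_unique[OF assms(3)] by blast
qed

end
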